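(* Let $A$ be a full rank $r\times n$ integer matrix ($r<n$) with greatest divisor $\delta(A)$, let $k=n-r$, and let $d>0$ be such that $\delta(A)$ divides $d$; write $d=p_1^{e_1}p_2^{e_2}\cdots p_l^{e_l}\,\delta(A)$ with $p_1,\dots,p_l$ distinct primes and $e_i\ge 1$. Then the number $N$ of fundamental solutions (equivalently, of L-A-equivalence classes of solutions of $\det\begin{bmatrix} A\\ X\end{bmatrix}=\pm d$) is $$N=\delta(A)^k\prod_{i=1}^{l}\left(\sum_{1\le j_1\le j_2\le\cdots\le j_{e_i}\le k} p_i^{\,e_i k-j_1-j_2-\cdots-j_{e_i}}\right).$$
   Context: An integer square matrix is unimodular if its determinant is $\pm1$. For a full rank integer $r\times n$ matrix $M$, $\delta(M)$ is the gcd of its $r\times r$ minors. $\begin{bmatrix} A\\ X\end{bmatrix}$ denotes the $n\times n$ matrix with the rows of $A$ above the rows of the $(n-r)\times n$ integer matrix $X$; $X$ is a solution if this determinant is $\pm d$. Two solutions $X_1,X_2$ are L-A-equivalent if $\begin{bmatrix} A\\ X_1\end{bmatrix}=W\begin{bmatrix} A\\ X_2\end{bmatrix}$ for some unimodular integer $W$. A square nonsingular integer matrix $(a_{ij})$ is in LHNF if it is lower triangular with nonnegative entries, $a_{ii}>0$ and $0\le a_{ji}<a_{ii}$ for $j>i$; in RHNF if lower triangular with nonnegative entries, $a_{ii}>0$ and $0\le a_{ij}<a_{ii}$ for $j<i$. Fundamental solutions: fix unimodular $U$ ($n\times n$) with $AU=[N\ O]$, $N$ in RHNF, and unimodular $U'$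 ($r\times r$) with $U'AU=[N'\ O]$, $N'$ in LHNF; the fundamental solutions are $BU^{-1}$ for all $(n-r)\times n$ integer $B$ such that $\begin{bmatrix} U'AU\\ B\end{bmatrix}$ is in LHNF with the product of its diagonal entries in positions $r+1,\dots,n$ equal to $d/\delta(A)$. Distinct such $B$ give distinct, pairwise non-L-A-equivalent solutions, and every solution is L-A-equivalent to one of them. *)

theory Defs
  imports
    "Jordan_Normal_Form.Determinant"
    "Jordan_Normal_Form.DL_Rank"
    "Jordan_Normal_Form.DL_Submatrix"
    "HOL-Computational_Algebra.Primes"
    "HOL.Equiv_Relations"
begin

(* Matrices are indexed from 0, so row and column i of the mathematics is row and column i - 1 here.
   The block matrix with A above X is A @\<^sub>r X. *)

definition unimodular :: "nat \<Rightarrow> int mat \<Rightarrow> bool" where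
  "unimodular n W \<longleftrightarrow> W \<in> carrier_mat n n \<and> (det W = 1 \<or> det W = -1)"

(* The rank is taken over the field of rationals. *)
definition full_row_rank :: "int mat \<Rightarrow> bool" where
  "full_row_rank A \<longleftrightarrow>
     vec_space.rank (dim_row A) (map_mat rat_of_int A) = dim_row A"

(* For a matrix with r rows and full row rank: the gcd of its r x r minors. *)
definition greatest_divisor :: "int mat \<Rightarrow> int" where
  "greatest_divisor A =
     Gcd {det (submatrix A UNIV J) | J. J \<subseteq> {..<dim_col A} \<and> card J = dim_row A}"

definition solutions :: "int mat \<Rightarrow> int \<Rightarrow> int mat set" where
  "solutions A d =
     {X \<in> carrier_mat (dim_col A - dim_row A) (dim_col A).
        det (A @\<^sub>r X) = d \<or> det (A @\<^sub>r X) = -d}"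

definition LA_equiv :: "int mat \<Rightarrow> int mat \<Rightarrow> int mat \<Rightarrow> bool" where
  "LA_equiv A X1 X2 \<longleftrightarrow>
     (\<exists>W. unimodular (dim_col A) W \<and> A @\<^sub>r X1 = W * (A @\<^sub>r X2))"

definition LA_classes :: "int mat \<Rightarrow> int \<Rightarrow> int mat set set" where
  "LA_classes A d =
     solutions A d //
       {(X1, X2). X1 \<in> solutions A d \<and> X2 \<in> solutions A d \<and> LA_equiv A X1 X2}"

definition lower_triangular_pos :: "nat \<Rightarrow> int mat \<Rightarrow> bool" where
  "lower_triangular_pos m M \<longleftrightarrow>
     M \<in> carrier_mat m m \<and>
     (\<forall>i<m. \<forall>j<m. i < j \<longrightarrow> M $$ (i, j) = 0) \<and>
     (\<forall>i<m. \<forall>j<m. 0 \<le> M $$ (i, j)) \<and>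
     (\<forall>i<m. 0 < M $$ (i, i))"

definition LHNF :: "nat \<Rightarrow> int mat \<Rightarrow> bool" where
  "LHNF m M \<longleftrightarrow> lower_triangular_pos m M \<and>
     (\<forall>i<m. \<forall>j<m. i < j \<longrightarrow> M $$ (j, i) < M $$ (i, i))"

definition RHNF :: "nat \<Rightarrow> int mat \<Rightarrow> bool" where
  "RHNF m M \<longleftrightarrow> lower_triangular_pos m M \<and>
     (\<forall>i<m. \<forall>j<m. j < i \<longrightarrow> M $$ (i, j) < M $$ (i, i))"

(* The block matrix [N O], with O having k columns. *)
definition pad_zero_cols :: "int mat \<Rightarrow> nat \<Rightarrow> int mat" where
  "pad_zero_cols N k =
     four_block_mat N (0\<^sub>m (dim_row N) k) (0\<^sub>m 0 (dim_col N)) (0\<^sub>m 0 k)"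

(* The pairs (U, U') from which fundamental solutions may be built. *)
definition reducing_pair :: "int mat \<Rightarrow> int mat \<Rightarrow> int mat \<Rightarrow> bool" where
  "reducing_pair A U U' \<longleftrightarrow>
     (let r = dim_row A; n = dim_col A in
        unimodular n U \<and>
        (\<exists>N. RHNF r N \<and> A * U = pad_zero_cols N (n - r)) \<and>
        unimodular r U' \<and>
        (\<exists>N'. LHNF r N' \<and> U' * A * U = pad_zero_cols N' (n - r)))"

(* The inverse of U is taken in the ring of n x n integer matrices. *)
definition fundamental_solutions ::
  "int mat \<Rightarrow> int \<Rightarrow> int mat \<Rightarrow> int mat \<Rightarrow> int mat set" where
  "fundamental_solutions A d U U' =
     (let r = dim_row A; n = dim_col A in
        {B * inv\<^bsub>ring_mat TYPE(int) n ()\<^esub> U | B.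
           B \<in> carrier_mat (n - r) n \<and>
           LHNF n (U' * A * U @\<^sub>r B) \<and>
           (\<Prod>i\<in>{r..<n}. (U' * A * U @\<^sub>r B) $$ (i, i)) = d div greatest_divisor A})"

(* The index sequences 1 <= j_1 <= ... <= j_e <= k. *)
definition index_sequences :: "nat \<Rightarrow> nat \<Rightarrow> nat list set" where
  "index_sequences e k = {js. length js = e \<and> sorted js \<and> set js \<subseteq> {1..k}}"

end

theory Submission
  imports Defs
begin

text \<open>
  After unimodular row and column operations \<open>A\<close> becomes \<open>[N O]\<close> with \<open>N\<close> in LHNF and
  \<open>det N = \<delta>(A)\<close>, and the L-A-equivalence class of a solution corresponds to the unique LHNF of the
  stacked matrix, whose first rows are \<open>[N O]\<close>. Its remaining rows are \<open>[B1 B2]\<close>: below the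
  diagonal of \<open>N\<close> the block \<open>B1\<close> can be chosen in \<open>\<delta>(A)^k\<close> ways, and \<open>B2\<close> is any \<open>k x k\<close> matrix
  in LHNF with determinant \<open>d / \<delta>(A)\<close>. The number \<open>c k m\<close> of such \<open>B2\<close> of determinant \<open>m\<close>
  satisfies \<open>c (k+1) m = (\<Sum>a | a dvd m. a^k * c k (m div a))\<close>, hence is multiplicative in \<open>m\<close>. For
  prime powers both \<open>c k (p^e)\<close> and the sum over index sequences in the theorem satisfy
  \<open>s (k+1) (e+1) = p^k * s (k+1) e + s k (e+1)\<close>; for the latter, split according to whether the
  sequence starts with 1.
\<close>

text \<open>The equivalence allows unimodular factors on the left only. Right multiplication by the
  fixed \<open>U\<close> is nevertheless harmless: it is invertible and commutes with all left
  multiplications, so it respects the classes. The zero block of [N O] then decouples the two parts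
  of \<open>B\<close>: \<open>B2\<close> alone decides triangularity and the remaining determinant,
  while \<open>B1\<close> only has to be reduced modulo the diagonal of \<open>N\<close>. Column
  \<open>j\<close> of \<open>B1\<close> has \<open>k\<close> entries with \<open>N $$ (j, j)\<close>
  choices each, so their total depends on \<open>det N\<close> only and not on how it is spread over
  the diagonal. In \<open>B2\<close> the entries lie below its own diagonal, so the count depends on
  the ordered factorization of the determinant; this is where arithmetic enters. The functions
  \<open>c k\<close> are iterated Dirichlet convolutions of the powers a^0, ..., a^(k-1), and
  \<open>c k m\<close> counts the sublattices of index \<open>m\<close> in Z^k. At p^e the value is
  therefore the complete homogeneous symmetric polynomial of degree e in 1, p, ..., p^(k-1). An
  index j in the theorem stands for the variable p^(k-j), which explains the exponent e*k - j_1 -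
  ... - j_e.\<close>

section \<open>Counting square matrices in LHNF\<close>

text \<open>\<open>hnf_weight xs\<close> is the number of matrices in LHNF with diagonal \<open>xs\<close>: the entry in position
  \<open>j\<close> bounds the entries below it, of which there are \<open>length xs - 1 - j\<close>.\<close>

fun hnf_weight :: "nat list \<Rightarrow> nat" where
  "hnf_weight [] = 1"
| "hnf_weight (a # xs) = a ^ length xs * hnf_weight xs"

definition diagonals :: "nat \<Rightarrow> nat \<Rightarrow> nat list set" where
  "diagonals k m = {xs. length xs = k \<and> prod_list xs = m}"

definition hnf_count :: "nat \<Rightarrow> nat \<Rightarrow> nat" where
  "hnf_count k m = (\<Sum>xs\<in>diagonals k m. hnf_weight xs)"

lemma hnf_weight_nth: "hnf_weight xs = (\<Prod>j<length xs. (xs ! j) ^ (length xs - Suc j))"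
  by (induction xs) (simp_all add: prod.lessThan_Suc_shift del: prod.lessThan_Suc)

lemma diagonals_Suc:
  assumes "m > 0"
  shows "diagonals (Suc k) m = (\<Union>a\<in>{a. a dvd m}. (#) a ` diagonals k (m div a))"
proof (intro equalityI subsetI)
  fix xs assume "xs \<in> diagonals (Suc k) m"
  then obtain a ys where "xs = a # ys" "length ys = k" "a * prod_list ys = m"
    by (auto simp: diagonals_def length_Suc_conv)
  moreover from this have "a dvd m" "a > 0" using assms by (auto intro: Nat.gr0I)
  ultimately show "xs \<in> (\<Union>a\<in>{a. a dvd m}. (#) a ` diagonals k (m div a))"
    by (auto simp: diagonals_def)
qed (auto simp: diagonals_def)

lemma finite_diagonals: "m > 0 \<Longrightarrow> finite (diagonals k m)"
proof (induction k arbitrary: m)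
  case 0
  have "diagonals 0 m \<subseteq> {[]}" by (auto simp: diagonals_def)
  then show ?case using finite_subset by blast
next
  case (Suc k)
  have "finite (diagonals k (m div a))" if "a dvd m" for a
    using that Suc.prems by (intro Suc.IH) (auto simp: div_greater_zero_iff dvd_imp_le Nat.gr0I)
  then show ?case
    using Suc.prems by (auto simp: diagonals_Suc)
qed

lemma hnf_count_0: "hnf_count 0 m = (if m = 1 then 1 else 0)"
proof -
  have "diagonals 0 m = (if m = 1 then {[]} else {})" by (auto simp: diagonals_def)
  then show ?thesis by (simp add: hnf_count_def)
qed

text \<open>The first diagonal entry \<open>a\<close> bounds the \<open>k\<close> entries below it,
  and the rest is a smaller matrix of determinant \<open>m div a\<close>. This is the Dirichlet
  convolution with the power function a^k.\<close>

lemma hnf_count_Suc: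
  assumes "m > 0"
  shows "hnf_count (Suc k) m = (\<Sum>a | a dvd m. a ^ k * hnf_count k (m div a))"
proof -
  have "finite (diagonals k (m div a))" if "a dvd m" for a
    using that assms by (intro finite_diagonals) (auto simp: div_greater_zero_iff dvd_imp_le Nat.gr0I)
  then have "hnf_count (Suc k) m = (\<Sum>a | a dvd m. sum hnf_weight ((#) a ` diagonals k (m div a)))"
    unfolding hnf_count_def diagonals_Suc[OF assms]
    using assms by (intro sum.UNION_disjoint) auto
  also have "\<dots> = (\<Sum>a | a dvd m. a ^ k * hnf_count k (m div a))"
    by (rule sum.cong) (auto simp: hnf_count_def sum_distrib_left sum.reindex diagonals_def intro!: sum.cong)
  finally show ?thesis .
qed

text \<open>The gcds with \<open>m\<close> and with \<open>n\<close> recover the two factors of a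
  divisor of \<open>m * n\<close>, so multiplication of divisors is a bijection.\<close>

lemma sum_divisors_coprime_mult:
  fixes f :: "nat \<Rightarrow> 'a :: comm_monoid_add"
  assumes "coprime m n"
  shows "(\<Sum>a | a dvd m * n. f a) = (\<Sum>(b, c)\<in>{b. b dvd m} \<times> {c. c dvd n}. f (b * c))"
proof (rule sum.reindex_bij_witness[of _ "\<lambda>(b, c). b * c" "\<lambda>a. (gcd a m, gcd a n)"])
  have gcds: "gcd (b * c) m = b" "gcd (b * c) n = c" if "b dvd m" "c dvd n" for b c
  proof -
    have "coprime m c" "coprime n b"
      using assms that by (metis coprime_commute coprime_divisors dvd_refl)+
    then show "gcd (b * c) m = b" "gcd (b * c) n = c"
      using that by (simp_all add: gcd_mult_left_right_cancel gcd_mult_left_left_cancel gcd_nat.absorb1)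
  qed
  show a_eq: "(case (gcd a m, gcd a n) of (b, c) \<Rightarrow> b * c) = a" if "a \<in> {a. a dvd m * n}" for a
  proof -
    from that have "a dvd m * n" by simp
    then obtain b c where "a = b * c" "b dvd m" "c dvd n"
      using division_decomp by blast
    then show ?thesis using gcds[of b c] by simp
  qed
  show "(\<lambda>a. (gcd a m, gcd a n)) (case bc of (b, c) \<Rightarrow> b * c) = bc"
    if "bc \<in> {b. b dvd m} \<times> {c. c dvd n}" for bc
    using that gcds by auto
  show "(case (gcd a m, gcd a n) of (b, c) \<Rightarrow> f (b * c)) = f a" if "a \<in> {a. a dvd m * n}" for a
    using a_eq[OF that] by simp
qed (auto simp: mult_dvd_mono)

text \<open>Dirichlet convolution preserves multiplicativity: over pairs of divisors both the power
  and, by induction, the count for \<open>k\<close> factor, so the sum becomes a product of two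
  sums.\<close>

lemma hnf_count_coprime_mult:
  assumes "coprime m n" "m > 0" "n > 0"
  shows "hnf_count k (m * n) = hnf_count k m * hnf_count k n"
  using assms
proof (induction k arbitrary: m n)
  case 0
  then show ?case by (simp add: hnf_count_0)
next
  case (Suc k)
  have "hnf_count (Suc k) (m * n) = (\<Sum>(b, c)\<in>{b. b dvd m} \<times> {c. c dvd n}.
      (b * c) ^ k * hnf_count k (m * n div (b * c)))"
    using Suc.prems by (simp add: hnf_count_Suc sum_divisors_coprime_mult)
  also have "\<dots> = (\<Sum>(b, c)\<in>{b. b dvd m} \<times> {c. c dvd n}.
      (b ^ k * hnf_count k (m div b)) * (c ^ k * hnf_count k (n div c)))"
  proof (rule sum.cong[OF refl], clarify)
    fix b c assume bc: "b dvd m" "c dvd n"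
    then have "coprime (m div b) (n div c)"
      using Suc.prems(1) by (metis coprime_divisors dvd_div_mult_self dvd_triv_left)
    moreover have "m * n div (b * c) = (m div b) * (n div c)"
      using bc by (simp add: div_mult_div_if_dvd)
    moreover have "m div b > 0" "n div c > 0"
      using bc Suc.prems by (auto simp: div_greater_zero_iff dvd_imp_le Nat.gr0I)
    ultimately show "(b * c) ^ k * hnf_count k (m * n div (b * c)) =
        (b ^ k * hnf_count k (m div b)) * (c ^ k * hnf_count k (n div c))"
      using Suc.IH by (simp add: power_mult_distrib)
  qed
  also have "\<dots> = hnf_count (Suc k) m * hnf_count (Suc k) n"
    using Suc.prems by (simp add: hnf_count_Suc sum_product sum.cartesian_product)
  finally show ?case .
qed

lemma hnf_count_1: "hnf_count k 1 = 1"
  by (induction k) (simp_all add: hnf_count_0 hnf_count_Suc)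

lemma hnf_count_prod_coprime:
  assumes "finite I" "\<And>i. i \<in> I \<Longrightarrow> q i > 0"
    "\<And>i j. i \<in> I \<Longrightarrow> j \<in> I \<Longrightarrow> i \<noteq> j \<Longrightarrow> coprime (q i) (q j)"
  shows "hnf_count k (\<Prod>i\<in>I. q i) = (\<Prod>i\<in>I. hnf_count k (q i))"
  using assms
proof (induction I rule: finite_induct)
  case empty
  then show ?case by (simp add: hnf_count_1[unfolded One_nat_def])
next
  case (insert i I)
  have "coprime (q i) (\<Prod>i\<in>I. q i)"
    using insert by (intro prod_coprime_right) (metis insert_iff)
  then show ?case
    using insert by (simp add: hnf_count_coprime_mult prod_pos)
qed

text \<open>Sum over the exponent of the first diagonal entry. Exponent 0 gives the count for
  \<open>k\<close>; all other terms contain the factor \<open>p ^ k\<close>, and removing it shifts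
  them to the sum for \<open>p ^ e\<close>.\<close>

lemma hnf_count_prime_power_Suc:
  assumes "prime p"
  shows "hnf_count (Suc k) (p ^ Suc e) =
    p ^ k * hnf_count (Suc k) (p ^ e) + hnf_count k (p ^ Suc e)"
proof -
  have p: "p > 1" using assms prime_gt_1_nat by blast
  have sum_powers: "hnf_count (Suc k) (p ^ e) = (\<Sum>i\<le>e. p ^ (i * k) * hnf_count k (p ^ (e - i)))" for e
  proof -
    have "{a. a dvd p ^ e} = (\<lambda>i. p ^ i) ` {..e}"
      using assms by (auto simp: divides_primepow_nat le_imp_power_dvd)
    moreover have "inj_on (\<lambda>i. p ^ i) {..e}"
      using p by (auto simp: inj_on_def)
    ultimately show ?thesis
      using p by (simp add: hnf_count_Suc sum.reindex power_mult power_diff)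
  qed
  show ?thesis
    unfolding sum_powers sum.atMost_Suc_shift sum_distrib_left
    by (simp add: algebra_simps power_add)
qed

section \<open>Index sequences and the formula for prime powers\<close>

lemma index_sequences_0: "index_sequences 0 k = {[]}"
  by (auto simp: index_sequences_def)

lemma index_sequences_Suc_0: "index_sequences (Suc e) 0 = {}"
  by (auto simp: index_sequences_def)

lemma finite_index_sequences: "finite (index_sequences e k)"
proof -
  have "index_sequences e k \<subseteq> {js. set js \<subseteq> {1..k} \<and> length js = e}"
    by (auto simp: index_sequences_def)
  then show ?thesis
    using finite_lists_length_eq[of "{1..k}" e] finite_subset by blast
qed

text \<open>Ensures that the exponent \<open>e * k - sum_list js\<close> is a genuine difference,
  not one truncated at 0.\<close>

lemma sum_list_index_sequences_le: "js \<in> index_sequences e k \<Longrightarrow> sum_list js \<le> e * k"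
  using sum_list_mono[of js "\<lambda>x. x" "\<lambda>_. k"]
  by (force simp: index_sequences_def sum_list_triv)

text \<open>A sorted sequence whose head is not 1 has all its entries at least 2, so lowering each
  of them by 1 leaves a sequence bounded by \<open>k\<close>.\<close>

lemma index_sequences_Suc:
  "index_sequences (Suc e) (Suc k) =
     (#) 1 ` index_sequences e (Suc k) \<union> map Suc ` index_sequences (Suc e) k"
proof (intro equalityI subsetI)
  fix js assume js: "js \<in> index_sequences (Suc e) (Suc k)"
  then obtain j js' where eq: "js = j # js'"
    by (auto simp: index_sequences_def length_Suc_conv)
  show "js \<in> (#) 1 ` index_sequences e (Suc k) \<union> map Suc ` index_sequences (Suc e) k"
  proof (cases "j = 1")
    case True
    then show ?thesis using js eq by (auto simp: index_sequences_def)
  next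
    case False
    then have ge: "\<forall>x\<in>set js. 2 \<le> x \<and> x \<le> Suc k"
      using js eq by (force simp: index_sequences_def)
    then have "map Suc (map (\<lambda>x. x - 1) js) = js"
      by (induction js) auto
    moreover have "sorted (map (\<lambda>x. x - 1) js)"
      using js unfolding sorted_map
      by (auto simp: index_sequences_def intro!: sorted_wrt_mono_rel[of js "(\<le>)"])
    then have "map (\<lambda>x. x - 1) js \<in> index_sequences (Suc e) k"
      using js ge by (fastforce simp: index_sequences_def)
    ultimately show ?thesis by (metis UnI2 image_eqI)
  qed
next
  fix js assume "js \<in> (#) 1 ` index_sequences e (Suc k) \<union> map Suc ` index_sequences (Suc e) k"
  moreover have "sorted (map Suc xs)" if "sorted xs" for xs
    using that by (induction xs) auto
  ultimately show "js \<in> index_sequences (Suc e) (Suc k)"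
    by (auto simp: index_sequences_def subset_iff Suc_le_eq)
qed

lemma hnf_count_prime_power:
  assumes "prime p"
  shows "hnf_count k (p ^ e) = (\<Sum>js\<in>index_sequences e k. p ^ (e * k - sum_list js))"
\<comment> \<open>The recurrence lowers either \<open>k\<close> or \<open>e\<close> in each of its
  terms, never both, so the induction runs on their sum.\<close>
proof (induction "k + e" arbitrary: k e rule: less_induct)
  case less
  consider "k = 0" "e = 0" | e' where "k = 0" "e = Suc e'" | k' where "k = Suc k'" "e = 0"
    | k' e' where "k = Suc k'" "e = Suc e'"
    by (metis not0_implies_Suc)
  then show ?case
  proof cases
    case 2
    then show ?thesis using prime_gt_1_nat[OF assms] by (simp add: hnf_count_0 index_sequences_Suc_0)
  next
    case 4
    let ?S = "\<lambda>e k. \<Sum>js\<in>index_sequences e k. p ^ (e * k - sum_list js)"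
    have fin: "finite ((#) 1 ` index_sequences e' k)" "finite (map Suc ` index_sequences e k')"
      by (simp_all add: finite_index_sequences)
    have disj: "(#) 1 ` index_sequences e' k \<inter> map Suc ` index_sequences e k' = {}"
      by (auto simp: index_sequences_def)
    \<comment> \<open>A leading 1 contributes \<open>k - 1\<close>, which is \<open>k'\<close>, to
      the exponent.\<close>
    have "p ^ (e * k - sum_list (1 # js)) = p ^ k' * p ^ (e' * k - sum_list js)"
      if "js \<in> index_sequences e' k" for js
    proof -
      have "e * k - sum_list (1 # js) = k' + (e' * k - sum_list js)"
        using sum_list_index_sequences_le[OF that] 4 by simp
      then show ?thesis by (simp add: power_add)
    qed
    \<comment> \<open>Raising all \<open>e\<close> entries by 1 uses up exactly the surplus of
      \<open>e * k\<close> over \<open>e * k'\<close>.\<close>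
    moreover have "p ^ (e * k - sum_list (map Suc js)) = p ^ (e * k' - sum_list js)"
      if "js \<in> index_sequences e k'" for js
    proof -
      have "sum_list (map Suc js) = sum_list js + e"
        using that by (simp add: index_sequences_def sum_list_Suc)
      then show ?thesis using 4 by simp
    qed
    ultimately have "(\<Sum>js\<in>(#) 1 ` index_sequences e' k. p ^ (e * k - sum_list js)) = p ^ k' * ?S e' k"
      "(\<Sum>js\<in>map Suc ` index_sequences e k'. p ^ (e * k - sum_list js)) = ?S e k'"
      by (subst sum.reindex; auto simp: sum_distrib_left inj_on_def intro!: sum.cong)+
    then have "?S e k = p ^ k' * ?S e' k + ?S e k'"
      using sum.union_disjoint[OF fin disj] index_sequences_Suc[of e' k'] 4 by metis
    moreover have "hnf_count k (p ^ e) = p ^ k' * hnf_count k (p ^ e') + hnf_count k' (p ^ e)"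
      using 4 hnf_count_prime_power_Suc[OF assms] by simp
    ultimately show ?thesis
      using less[of k e'] less[of k' e] 4 by simp
  qed (simp_all add: hnf_count_0 index_sequences_0 hnf_count_1[unfolded One_nat_def])
qed

section \<open>Existence and uniqueness of the LHNF\<close>

lemma index_mult_mat_sum:
  assumes "A \<in> carrier_mat m k" "B \<in> carrier_mat k n" "i < m" "j < n"
  shows "(A * B) $$ (i, j) = (\<Sum>l<k. A $$ (i, l) * B $$ (l, j))"
  using assms by (auto simp: scalar_prod_def atLeast0LessThan intro!: sum.cong)

lemma det_lower_triangular_prod:
  fixes M :: "'a :: comm_ring_1 mat"
  assumes "M \<in> carrier_mat n n" "\<And>i j. i < j \<Longrightarrow> j < n \<Longrightarrow> M $$ (i, j) = 0"
  shows "det M = (\<Prod>i<n. M $$ (i, i))"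
  using det_lower_triangular[OF assms(2,1)] assms(1)
  by (simp add: prod_list_diag_prod atLeast0LessThan)

section \<open>Unimodular matrices\<close>

lemma unimodular_carrier: "unimodular n U \<Longrightarrow> U \<in> carrier_mat n n"
  by (simp add: unimodular_def)

lemma unimodular_one: "unimodular n (1\<^sub>m n)"
  by (simp add: unimodular_def)

lemma unimodular_mult: "unimodular n U \<Longrightarrow> unimodular n V \<Longrightarrow> unimodular n (U * V)"
  by (auto simp: unimodular_def det_mult)

text \<open>The adjugate times the determinant is an integral inverse when the determinant squares
  to 1; conversely, two integers with product 1 are both 1 or both -1.\<close>

lemma unimodular_iff_right_inverse:
  "unimodular n U \<longleftrightarrow> U \<in> carrier_mat n n \<and> (\<exists>V \<in> carrier_mat n n. U * V = 1\<^sub>m n)"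
proof (intro iffI conjI)
  assume "unimodular n U"
  then have U: "U \<in> carrier_mat n n" and d: "det U * det U = 1"
    by (auto simp: unimodular_def)
  have "U * (det U \<cdot>\<^sub>m adj_mat U) = (det U * det U) \<cdot>\<^sub>m 1\<^sub>m n"
    using adj_mat[OF U] U by (auto simp: mult_smult_distrib[of _ n n _ n] intro!: eq_matI)
  then show "\<exists>V \<in> carrier_mat n n. U * V = 1\<^sub>m n"
    using adj_mat(1)[OF U] d by (intro bexI[of _ "det U \<cdot>\<^sub>m adj_mat U"]) auto
  show "U \<in> carrier_mat n n" by fact
next
  assume "U \<in> carrier_mat n n \<and> (\<exists>V \<in> carrier_mat n n. U * V = 1\<^sub>m n)"
  then obtain V where V: "U \<in> carrier_mat n n" "V \<in> carrier_mat n n" "U * V = 1\<^sub>m n" by blast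
  then have "det U * det V = 1" using det_mult[of U n V] by simp
  then show "unimodular n U" using V(1) by (auto simp: unimodular_def zmult_eq_1_iff)
qed

lemma unimodular_inverse:
  assumes "unimodular n U"
  obtains V where "unimodular n V" "U * V = 1\<^sub>m n" "V * U = 1\<^sub>m n"
proof -
  have U: "U \<in> carrier_mat n n" by (rule unimodular_carrier[OF assms])
  obtain V where V: "V \<in> carrier_mat n n" "U * V = 1\<^sub>m n"
    using assms unimodular_iff_right_inverse by blast
  then have "det U * det V = 1" using U det_mult[of U n V] by simp
  then have uV: "unimodular n V" using V by (auto simp: unimodular_def zmult_eq_1_iff)
  then obtain U' where U': "U' \<in> carrier_mat n n" "V * U' = 1\<^sub>m n"
    using unimodular_iff_right_inverse by blast
  \<comment> \<open>A right inverse of the right inverse \<open>V\<close> has to be \<open>U\<close>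
    itself, so \<open>V\<close> is a two-sided inverse.\<close>
  have "U = U * (V * U')" unfolding U'(2) using U by simp
  also have "\<dots> = (U * V) * U'" by (rule assoc_mult_mat[OF U V(1) U'(1), symmetric])
  also have "\<dots> = U'" unfolding V(2) using U'(1) by simp
  finally have "V * U = 1\<^sub>m n" using U' by simp
  then show ?thesis using that uV V by blast
qed

text \<open>Euclid's algorithm on the entries of row \<open>s\<close> in the columns from \<open>s\<close> on: the sum of their
  absolute values decreases as long as two of them are nonzero.\<close>

lemma clear_row_right_of_diagonal:
  fixes M :: "int mat"
  assumes "M \<in> carrier_mat m n" and s: "s < m" "s < n"
    and "\<And>i j. i < s \<Longrightarrow> i < j \<Longrightarrow> j < n \<Longrightarrow> M $$ (i, j) = 0"
  shows "\<exists>U. unimodular n U \<and> (\<forall>i\<le>s. \<forall>j<n. i < j \<longrightarrow> (M * U) $$ (i, j) = 0)"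
  using assms(1,4)
proof (induction "\<Sum>j=s..<n. nat \<bar>M $$ (s, j)\<bar>" arbitrary: M rule: less_induct)
  case less
  note M = less.prems(1) and Z = less.prems(2)
  show ?case
  proof (cases "\<exists>j1\<in>{s..<n}. \<exists>j2\<in>{s..<n}. j1 \<noteq> j2 \<and> M $$ (s, j1) \<noteq> 0 \<and> \<bar>M $$ (s, j1)\<bar> \<le> \<bar>M $$ (s, j2)\<bar>")
    case True
    then obtain j1 j2 where j: "s \<le> j1" "j1 < n" "s \<le> j2" "j2 < n" "j1 \<noteq> j2"
      and nz: "M $$ (s, j1) \<noteq> 0" and le: "\<bar>M $$ (s, j1)\<bar> \<le> \<bar>M $$ (s, j2)\<bar>" by auto
    \<comment> \<open>With this sign the added multiple is opposed to the entry in column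
      \<open>j2\<close>, so the absolute value of that entry drops by that of the nonzero entry in
      column \<open>j1\<close>.\<close>
    define a where "a = - sgn (M $$ (s, j1)) * sgn (M $$ (s, j2))"
    define E where "E = addrow_mat n a j1 j2"
    have E: "unimodular n E" using j by (simp add: E_def unimodular_def det_addrow_mat)
    have ME: "M * E = addcol a j2 j1 M" using addcol_mat[OF M] j by (simp add: E_def)
    have idx: "(M * E) $$ (i, l) = (if j2 = l then a * M $$ (i, j1) + M $$ (i, l) else M $$ (i, l))"
      if "i < m" "l < n" for i l using that M unfolding ME by simp
    have lt: "\<bar>(M * E) $$ (s, j2)\<bar> < \<bar>M $$ (s, j2)\<bar>"
      using idx[OF s(1) j(4)] nz le unfolding a_def by (auto simp: sgn_if)
    have "(\<Sum>l=s..<n. nat \<bar>(M * E) $$ (s, l)\<bar>) < (\<Sum>l=s..<n. nat \<bar>M $$ (s, l)\<bar>)"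
    proof (rule sum_strict_mono_ex1)
      show "\<forall>l\<in>{s..<n}. nat \<bar>(M * E) $$ (s, l)\<bar> \<le> nat \<bar>M $$ (s, l)\<bar>"
      proof
        fix l assume "l \<in> {s..<n}"
        then show "nat \<bar>(M * E) $$ (s, l)\<bar> \<le> nat \<bar>M $$ (s, l)\<bar>"
          using lt idx[OF s(1), of l] by (cases "l = j2") auto
      qed
      show "\<exists>l\<in>{s..<n}. nat \<bar>(M * E) $$ (s, l)\<bar> < nat \<bar>M $$ (s, l)\<bar>"
        using lt j by (intro bexI[of _ j2]) auto
    qed simp
    moreover have MEc: "M * E \<in> carrier_mat m n" using M unimodular_carrier[OF E] by simp
    \<comment> \<open>In the rows before \<open>s\<close> both columns lie to the right of the
      diagonal, where all entries are already zero.\<close>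
    moreover have "(M * E) $$ (i, l) = 0" if "i < s" "i < l" "l < n" for i l
      using that Z[of i l] Z[of i j1] j s idx[of i l] by simp
    ultimately obtain U where U: "unimodular n U"
      "\<forall>i\<le>s. \<forall>l<n. i < l \<longrightarrow> ((M * E) * U) $$ (i, l) = 0"
      using less.hyps by blast
    have "(M * E) * U = M * (E * U)"
      by (rule assoc_mult_mat[OF M unimodular_carrier[OF E] unimodular_carrier[OF U(1)]])
    then show ?thesis using U unimodular_mult[OF E U(1)] by auto
  next
    case False
    show ?thesis
    proof (cases "\<exists>j0. s < j0 \<and> j0 < n \<and> M $$ (s, j0) \<noteq> 0")
      case True
      then obtain j0 where j0: "s < j0" "j0 < n" "M $$ (s, j0) \<noteq> 0" by blast
      \<comment> \<open>Of two nonzero entries one would be at most the other in absolute value and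
        allow a further step. So \<open>j0\<close> is the only column left with a nonzero entry, and
        a swap brings it to the diagonal.\<close>
      have Zs: "M $$ (s, l) = 0" if "s \<le> l" "l < n" "l \<noteq> j0" for l
        using False j0 that by (metis atLeastLessThan_iff linorder_le_cases less_imp_le)
      let ?E = "swaprows_mat n s j0"
      have "unimodular n ?E" using j0 s by (simp add: unimodular_def det_swaprows_mat)
      moreover have ME: "M * ?E = swapcols s j0 M" using swapcols_mat[OF M s(2) j0(2)] by simp
      have "(M * ?E) $$ (i, l) = 0" if "i \<le> s" "l < n" "i < l" for i l
        using that Z[of i l] Z[of i s] Z[of i j0] Zs[of l] Zs[of s] M s j0
        unfolding ME by (cases "i = s") auto
      ultimately show ?thesis by blast
    next
      case none: False
      have "(M * 1\<^sub>m n) $$ (i, l) = 0" if "i \<le> s" "l < n" "i < l" for i l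
        using that Z[of i l] none M by (cases "i = s") auto
      then show ?thesis using unimodular_one by blast
    qed
  qed
qed

lemma ex_unimodular_lower_triangular:
  fixes M :: "int mat"
  assumes M: "M \<in> carrier_mat m n"
  shows "\<exists>U. unimodular n U \<and> (\<forall>i<m. \<forall>j<n. i < j \<longrightarrow> (M * U) $$ (i, j) = 0)"
proof -
  have "\<exists>U. unimodular n U \<and> (\<forall>i<t. \<forall>j<n. i < j \<longrightarrow> (M * U) $$ (i, j) = 0)" if "t \<le> m" for t
    using that
  proof (induction t)
    case 0
    then show ?case using unimodular_one by auto
  next
    case (Suc t)
    then obtain U where U: "unimodular n U"
      "\<forall>i<t. \<forall>j<n. i < j \<longrightarrow> (M * U) $$ (i, j) = 0" by auto
    show ?case
    proof (cases "t < n")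
      case True
      have "M * U \<in> carrier_mat m n" using M unimodular_carrier[OF U(1)] by simp
      then obtain V where V: "unimodular n V"
        "\<forall>i\<le>t. \<forall>j<n. i < j \<longrightarrow> (M * U * V) $$ (i, j) = 0"
        using clear_row_right_of_diagonal[of "M * U" m n t] U(2) Suc.prems True by auto
      have "M * U * V = M * (U * V)"
        by (rule assoc_mult_mat[OF M unimodular_carrier[OF U(1)] unimodular_carrier[OF V(1)]])
      then show ?thesis using V unimodular_mult[OF U(1) V(1)] by (auto simp: less_Suc_eq_le)
    next
      case False
      then show ?thesis using U by (intro exI[of _ U]) (auto simp: less_Suc_eq)
    qed
  qed
  then show ?thesis by blast
qed

lemma mult_diagonal_mat_index:
  fixes M :: "'a :: comm_semiring_1 mat"
  assumes "M \<in> carrier_mat m n" "i < m" "j < n"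
  shows "(M * mat n n (\<lambda>(i, j). if i = j then c j else 0)) $$ (i, j) = M $$ (i, j) * c j"
proof -
  have "(M * mat n n (\<lambda>(i, j). if i = j then c j else 0)) $$ (i, j) =
      (\<Sum>l<n. if l = j then M $$ (i, l) * c j else 0)"
    using assms by (subst index_mult_mat_sum[of _ m n _ n]) (auto simp: if_distrib cong: if_cong intro!: sum.cong)
  also have "\<dots> = M $$ (i, j) * c j" using assms by simp
  finally show ?thesis .
qed

lemma ex_unimodular_lower_triangular_nonneg:
  fixes M :: "int mat"
  assumes M: "M \<in> carrier_mat m n"
  shows "\<exists>U. unimodular n U \<and> (\<forall>i<m. \<forall>j<n. i < j \<longrightarrow> (M * U) $$ (i, j) = 0) \<and>
    (\<forall>i<m. i < n \<longrightarrow> 0 \<le> (M * U) $$ (i, i))"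
proof -
  obtain U where U: "unimodular n U" and Z: "\<forall>i<m. \<forall>j<n. i < j \<longrightarrow> (M * U) $$ (i, j) = 0"
    using ex_unimodular_lower_triangular[OF M] by blast
  have MU: "M * U \<in> carrier_mat m n" using M unimodular_carrier[OF U] by simp
  \<comment> \<open>Negating the columns with a negative diagonal entry keeps all zeros, and a
    diagonal matrix of signs is its own inverse.\<close>
  define c where "c j = (if (M * U) $$ (j, j) < 0 then -1 else 1 :: int)" for j
  define S where "S = mat n n (\<lambda>(i, j). if i = j then c j else 0)"
  have S: "S \<in> carrier_mat n n" by (simp add: S_def)
  have "S * S = 1\<^sub>m n"
  proof (rule eq_matI)
    fix i j assume "i < dim_row (1\<^sub>m n)" "j < dim_col (1\<^sub>m n)"
    then have ij: "i < n" "j < n" by auto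
    have "(S * S) $$ (i, j) = S $$ (i, j) * c j"
      using mult_diagonal_mat_index[OF S ij, of c] by (simp only: S_def)
    then show "(S * S) $$ (i, j) = 1\<^sub>m n $$ (i, j)" using ij by (simp add: S_def c_def)
  qed (use S in auto)
  then have uS: "unimodular n S" using S unimodular_iff_right_inverse by blast
  have "M * (U * S) = M * U * S"
    by (rule assoc_mult_mat[OF M unimodular_carrier[OF U] S, symmetric])
  then have "(M * (U * S)) $$ (i, j) = (M * U) $$ (i, j) * c j" if "i < m" "j < n" for i j
    using mult_diagonal_mat_index[OF MU that, of c] by (simp add: S_def)
  then show ?thesis
    using Z unimodular_mult[OF U uS] by (intro exI[of _ "U * S"]) (auto simp: c_def)
qed

text \<open>Reflection in the antidiagonal reverses products but preserves lower triangular matrices, so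
  it turns column operations into row operations.\<close>

definition antitranspose :: "nat \<Rightarrow> 'a mat \<Rightarrow> 'a mat" where
  "antitranspose n M = mat n n (\<lambda>(i, j). M $$ (n - Suc j, n - Suc i))"

lemma antitranspose_carrier [simp]: "antitranspose n M \<in> carrier_mat n n"
  by (simp add: antitranspose_def)

lemma antitranspose_index [simp]:
  "i < n \<Longrightarrow> j < n \<Longrightarrow> antitranspose n M $$ (i, j) = M $$ (n - Suc j, n - Suc i)"
  by (simp add: antitranspose_def)

lemma antitranspose_antitranspose:
  "M \<in> carrier_mat n n \<Longrightarrow> antitranspose n (antitranspose n M) = M"
  by (intro eq_matI) (auto simp: antitranspose_def)

lemma antitranspose_mult:
  fixes A :: "'a :: comm_semiring_0 mat"
  assumes "A \<in> carrier_mat n n" "B \<in> carrier_mat n n"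
  shows "antitranspose n (A * B) = antitranspose n B * antitranspose n A"
proof (rule eq_matI)
  fix i j assume "i < dim_row (antitranspose n B * antitranspose n A)"
    "j < dim_col (antitranspose n B * antitranspose n A)"
  then have ij: "i < n" "j < n" by (auto simp: antitranspose_def)
  have "(antitranspose n B * antitranspose n A) $$ (i, j) =
      (\<Sum>l<n. A $$ (n - Suc j, n - Suc l) * B $$ (n - Suc l, n - Suc i))"
    using ij by (subst index_mult_mat_sum[of _ n n _ n]) (auto simp: mult.commute)
  also have "\<dots> = (\<Sum>l<n. A $$ (n - Suc j, l) * B $$ (l, n - Suc i))"
    by (rule sum.nat_diff_reindex)
  finally show "antitranspose n (A * B) $$ (i, j) = (antitranspose n B * antitranspose n A) $$ (i, j)"
    using ij index_mult_mat_sum[OF assms, of "n - Suc j" "n - Suc i"] by simp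
qed (auto simp: antitranspose_def)

lemma unimodular_antitranspose:
  assumes "unimodular n U"
  shows "unimodular n (antitranspose n U)"
proof -
  obtain V where V: "unimodular n V" "V * U = 1\<^sub>m n" using unimodular_inverse[OF assms] by blast
  have "antitranspose n U * antitranspose n V = antitranspose n (1\<^sub>m n)"
    using antitranspose_mult[of V n U] V assms unimodular_carrier by auto
  also have "\<dots> = (1\<^sub>m n :: int mat)" by (intro eq_matI) (auto simp: antitranspose_def)
  finally show ?thesis unfolding unimodular_iff_right_inverse by (meson antitranspose_carrier)
qed

lemma ex_unimodular_left_lower_triangular_nonneg:
  fixes M :: "int mat"
  assumes M: "M \<in> carrier_mat n n"
  shows "\<exists>V. unimodular n V \<and> (\<forall>i<n. \<forall>j<n. i < j \<longrightarrow> (V * M) $$ (i, j) = 0) \<and>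
    (\<forall>i<n. 0 \<le> (V * M) $$ (i, i))"
proof -
  obtain U where U: "unimodular n U"
    and Z: "\<forall>i<n. \<forall>j<n. i < j \<longrightarrow> (antitranspose n M * U) $$ (i, j) = 0"
    and P: "\<forall>i<n. 0 \<le> (antitranspose n M * U) $$ (i, i)"
    using ex_unimodular_lower_triangular_nonneg[OF antitranspose_carrier[of n M]] by auto
  have "antitranspose n U * M = antitranspose n (antitranspose n M * U)"
    using antitranspose_mult[of "antitranspose n M" n U] unimodular_carrier[OF U]
    by (simp add: antitranspose_antitranspose[OF M])
  then show ?thesis
    using Z P unimodular_antitranspose[OF U] by (intro exI[of _ "antitranspose n U"]) auto
qed

text \<open>The columns are treated from right to left. A multiple of row \<open>i\<close> of
  \<open>T\<close> turns the entry in column \<open>i\<close> into its remainder modulo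
  \<open>T i i\<close>; the rows used afterwards have a smaller index and vanish in column
  \<open>i\<close>. The coefficients of the rows are collected in \<open>w\<close>.\<close>

lemma ex_reduced_row:
  fixes T :: "nat \<Rightarrow> nat \<Rightarrow> int"
  assumes Z: "\<And>i j. i < j \<Longrightarrow> j < n \<Longrightarrow> T i j = 0" and P: "\<And>i. i < n \<Longrightarrow> 0 < T i i"
    and "i \<le> n"
  shows "\<exists>w. (\<forall>l\<ge>i. w l = 0) \<and>
    (\<forall>j<i. 0 \<le> v j + (\<Sum>l<n. w l * T l j) \<and> v j + (\<Sum>l<n. w l * T l j) < T j j)"
  using assms(3)
proof (induction i arbitrary: v)
  case 0
  show ?case by (rule exI[of _ "\<lambda>_. 0"]) simp
next
  case (Suc i)
  define q where "q = v i div T i i"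
  obtain w where w: "\<forall>l\<ge>i. w l = 0"
    and red: "\<forall>j<i. 0 \<le> (v j - q * T i j) + (\<Sum>l<n. w l * T l j) \<and>
      (v j - q * T i j) + (\<Sum>l<n. w l * T l j) < T j j"
    using Suc.IH[of "\<lambda>j. v j - q * T i j"] Suc.prems by auto
  define w' where "w' = w(i := - q)"
  have sum_eq: "(\<Sum>l<n. w' l * T l j) = (\<Sum>l<n. w l * T l j) - q * T i j" for j
  proof -
    have "(\<Sum>l<n. w' l * T l j) = (\<Sum>l<n. w l * T l j + (if l = i then - q * T i j else 0))"
      using w by (intro sum.cong) (auto simp: w'_def)
    then show ?thesis using Suc.prems by (simp add: sum.distrib)
  qed
  have "(\<Sum>l<n. w l * T l i) = 0"
    using w Z Suc.prems by (intro sum.neutral) (metis Suc_le_lessD leI lessThan_iff mult_eq_0_iff)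
  then have "v i + (\<Sum>l<n. w' l * T l i) = v i mod T i i"
    by (simp add: sum_eq q_def minus_div_mult_eq_mod)
  moreover have "0 < T i i" using P Suc.prems by simp
  ultimately have "0 \<le> v i + (\<Sum>l<n. w' l * T l i) \<and> v i + (\<Sum>l<n. w' l * T l i) < T i i"
    by simp
  then have "\<forall>j<Suc i. 0 \<le> v j + (\<Sum>l<n. w' l * T l j) \<and> v j + (\<Sum>l<n. w' l * T l j) < T j j"
    using red by (auto simp: less_Suc_eq sum_eq algebra_simps)
  moreover have "\<forall>l\<ge>Suc i. w' l = 0" using w by (simp add: w'_def)
  ultimately show ?case by blast
qed

text \<open>Each row is reduced independently by multiples of earlier rows of the original
  \<open>T\<close>, so the combined operation is unit lower triangular. The parameter
  \<open>r\<close> marks top rows that are already reduced and must stay as they are; later these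
  are the rows of [N O].\<close>

lemma ex_unimodular_LHNF:
  fixes T :: "int mat"
  assumes T: "T \<in> carrier_mat n n"
    and Z: "\<And>i j. i < j \<Longrightarrow> j < n \<Longrightarrow> T $$ (i, j) = 0" and P: "\<And>i. i < n \<Longrightarrow> 0 < T $$ (i, i)"
    and red: "\<And>i j. i < r \<Longrightarrow> j < i \<Longrightarrow> 0 \<le> T $$ (i, j) \<and> T $$ (i, j) < T $$ (j, j)"
  shows "\<exists>W. unimodular n W \<and> LHNF n (W * T) \<and> (\<forall>i<n. (W * T) $$ (i, i) = T $$ (i, i)) \<and>
    (\<forall>i<r. \<forall>j<n. i < n \<longrightarrow> (W * T) $$ (i, j) = T $$ (i, j))"
proof -
  let ?R = "\<lambda>i w j. T $$ (i, j) + (\<Sum>l<n. w l * T $$ (l, j))"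
  define Q where "Q i w \<longleftrightarrow> (\<forall>l\<ge>i. w l = 0) \<and> (i < r \<longrightarrow> w = (\<lambda>_. 0)) \<and>
    (\<forall>j<i. 0 \<le> ?R i w j \<and> ?R i w j < T $$ (j, j))" for i w
  have "\<exists>w. Q i w" if "i < n" for i
  proof (cases "i < r")
    case True
    then show ?thesis using red unfolding Q_def by (intro exI[of _ "\<lambda>_. 0"]) simp
  next
    case False
    then show ?thesis
      using ex_reduced_row[of n "\<lambda>i j. T $$ (i, j)" i "\<lambda>j. T $$ (i, j)"] Z P that
      unfolding Q_def by auto
  qed
  then obtain w where "\<And>i. i < n \<Longrightarrow> Q i (w i)" by metis
  then have w0: "\<And>i l. i < n \<Longrightarrow> i \<le> l \<Longrightarrow> w i l = 0"
    and wr: "\<And>i. i < n \<Longrightarrow> i < r \<Longrightarrow> w i = (\<lambda>_. 0)"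
    and wred: "\<And>i j. i < n \<Longrightarrow> j < i \<Longrightarrow> 0 \<le> ?R i (w i) j \<and> ?R i (w i) j < T $$ (j, j)"
    unfolding Q_def by blast+
  define W where "W = mat n n (\<lambda>(i, j). if i = j then 1 else w i j)"
  have W: "W \<in> carrier_mat n n" by (simp add: W_def)
  have "det W = 1"
    using w0 by (subst det_lower_triangular_prod[OF W]) (auto simp: W_def)
  then have uW: "unimodular n W" using W by (simp add: unimodular_def)
  have idx: "(W * T) $$ (i, j) = ?R i (w i) j" if "i < n" "j < n" for i j
  proof -
    have "(W * T) $$ (i, j) = (\<Sum>l<n. W $$ (i, l) * T $$ (l, j))"
      by (rule index_mult_mat_sum[OF W T that])
    also have "\<dots> = (\<Sum>l<n. (if l = i then T $$ (i, j) else 0) + w i l * T $$ (l, j))"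
      using that w0[of i i] by (intro sum.cong) (auto simp: W_def)
    also have "\<dots> = ?R i (w i) j" using that by (subst sum.distrib) simp
    finally show ?thesis .
  qed
  \<comment> \<open>The rows added to row \<open>i\<close> come earlier and vanish from column
    \<open>i\<close> on. Hence the diagonal is preserved, and entries reduced modulo the old
    diagonal are reduced modulo the new one.\<close>
  have top: "(W * T) $$ (i, j) = T $$ (i, j)" if "i < n" "j < n" "i \<le> j" for i j
  proof -
    have "w i l * T $$ (l, j) = 0" if "l < n" for l
      using w0[of i l] Z[of l j] \<open>i < n\<close> \<open>j < n\<close> \<open>i \<le> j\<close> by (cases "l < i") simp_all
    then have "(\<Sum>l<n. w i l * T $$ (l, j)) = 0" by (intro sum.neutral) simp
    then show ?thesis using that by (simp add: idx)
  qed
  have "LHNF n (W * T)"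
    unfolding LHNF_def lower_triangular_pos_def
  proof (intro conjI allI impI)
    fix i j assume ij: "i < n" "j < n"
    show "0 \<le> (W * T) $$ (i, j)"
      using ij top[of i j] Z[of i j] P[of i] wred[of i j] idx[of i j]
      by (cases i j rule: linorder_cases) simp_all
    show "(W * T) $$ (i, j) = 0" if "i < j" using ij that top[of i j] Z[of i j] by simp
    show "(W * T) $$ (j, i) < (W * T) $$ (i, i)" if "i < j"
      using ij that top[of i i] wred[of j i] idx[of j i] by simp
  next
    show "0 < (W * T) $$ (i, i)" if "i < n" for i using that top[of i i] P[of i] by simp
    show "W * T \<in> carrier_mat n n" using W T by simp
  qed
  then show ?thesis using uW top wr by (intro exI[of _ W]) (simp add: idx)
qed

lemma LHNF_D:
  assumes "LHNF n M"
  shows "M \<in> carrier_mat n n"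
    and "\<And>i j. i < j \<Longrightarrow> j < n \<Longrightarrow> M $$ (i, j) = 0"
    and "\<And>i j. i < n \<Longrightarrow> j < n \<Longrightarrow> 0 \<le> M $$ (i, j)"
    and "\<And>i. i < n \<Longrightarrow> 0 < M $$ (i, i)"
    and "\<And>i j. j < i \<Longrightarrow> i < n \<Longrightarrow> M $$ (i, j) < M $$ (j, j)"
  using assms by (auto simp: LHNF_def lower_triangular_pos_def)

text \<open>Comparing entries forces \<open>W\<close> to be the identity: it is lower triangular,
  its diagonal entries are positive units, and each entry below the diagonal is the quotient by a
  diagonal entry of a difference of two remainders.\<close>

lemma LHNF_unique:
  assumes H1: "LHNF n H1" and H2: "LHNF n H2" and uW: "unimodular n W" and eq: "H1 = W * H2"
  shows "H1 = H2"
proof -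
  have W: "W \<in> carrier_mat n n" by (rule unimodular_carrier[OF uW])
  have Z1: "i < j \<Longrightarrow> j < n \<Longrightarrow> H1 $$ (i, j) = 0" and Z2: "i < j \<Longrightarrow> j < n \<Longrightarrow> H2 $$ (i, j) = 0"
    and P1: "i < n \<Longrightarrow> 0 < H1 $$ (i, i)" and P2: "i < n \<Longrightarrow> 0 < H2 $$ (i, i)"
    and R1: "j < i \<Longrightarrow> i < n \<Longrightarrow> 0 \<le> H1 $$ (i, j) \<and> H1 $$ (i, j) < H1 $$ (j, j)"
    and R2: "j < i \<Longrightarrow> i < n \<Longrightarrow> 0 \<le> H2 $$ (i, j) \<and> H2 $$ (i, j) < H2 $$ (j, j)" for i j
    using H1 H2 unfolding LHNF_def lower_triangular_pos_def by auto
  have C2: "H2 \<in> carrier_mat n n" using H2 unfolding LHNF_def lower_triangular_pos_def by blast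
  have idx: "H1 $$ (i, j) = (\<Sum>l<n. W $$ (i, l) * H2 $$ (l, j))" if "i < n" "j < n" for i j
    unfolding eq by (rule index_mult_mat_sum[OF W C2 that])
  have pick: "(\<Sum>l<n. f l) = f j" if "j < n" "\<And>l. l < n \<Longrightarrow> l \<noteq> j \<Longrightarrow> f l = 0"
    for f :: "nat \<Rightarrow> int" and j
    using that by (subst sum.remove[of _ j]) (auto intro!: sum.neutral)
  have upper: "W $$ (i, j) = 0" if "i < j" "j < n" for i j
    using that
  \<comment> \<open>From right to left: for \<open>l > j\<close> the entry of \<open>W\<close> is
    already known to vanish, for \<open>l < j\<close> that of \<open>H2\<close> does, so one term of
    the sum remains.\<close>
  proof (induction "n - j" arbitrary: j rule: less_induct)
    case less
    have "W $$ (i, l) * H2 $$ (l, j) = 0" if "l < n" "l \<noteq> j" for l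
      using that less Z2[of l j] by (cases "l < j") auto
    then have "H1 $$ (i, j) = W $$ (i, j) * H2 $$ (j, j)"
      using less.prems by (subst idx, simp_all) (rule pick, auto)
    then show ?case using Z1[of i j] P2[of j] less.prems by simp
  qed
  have diag: "H1 $$ (i, i) = W $$ (i, i) * H2 $$ (i, i)" if "i < n" for i
  proof -
    have "W $$ (i, l) * H2 $$ (l, i) = 0" if "l < n" "l \<noteq> i" for l
      using that \<open>i < n\<close> upper[of i l] Z2[of l i] by (cases "l < i") auto
    then show ?thesis using that by (subst idx, simp_all) (rule pick, auto)
  qed
  have W1: "W $$ (i, i) = 1" if "i < n" for i
  proof -
    \<comment> \<open>A factor of the determinant, which is 1 or -1, is a unit; its sign follows
      from the two positive diagonals.\<close>
    have "W $$ (i, i) dvd (\<Prod>i<n. W $$ (i, i))" using that by (intro dvd_prodI) auto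
    also have "\<dots> = det W" using det_lower_triangular_prod[OF W upper] by simp
    also have "\<dots> dvd 1" using uW by (auto simp: unimodular_def)
    finally have "\<bar>W $$ (i, i)\<bar> = 1" by simp
    moreover have "0 < W $$ (i, i)"
      using diag[OF that] P1[OF that] P2[OF that] by (metis zero_less_mult_pos2)
    ultimately show ?thesis by simp
  qed
  have lower: "W $$ (i, j) = 0" if "j < i" "i < n" for i j
    using that
  proof (induction "i - j" arbitrary: j rule: less_induct)
    case less
    have "W $$ (i, l) * H2 $$ (l, j) = 0" if "l < n" "l \<noteq> j" "l \<noteq> i" for l
    proof -
      consider "l < j" | "j < l" "l < i" | "i < l" using \<open>l \<noteq> j\<close> \<open>l \<noteq> i\<close> by linarith
      then show ?thesis using less upper[of i l] Z2[of l j] \<open>l < n\<close> by cases auto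
    qed
    then have "(\<Sum>l<n. W $$ (i, l) * H2 $$ (l, j)) = (\<Sum>l\<in>{i, j}. W $$ (i, l) * H2 $$ (l, j))"
      using less.prems by (intro sum.mono_neutral_right) auto
    then have "H1 $$ (i, j) = W $$ (i, i) * H2 $$ (i, j) + W $$ (i, j) * H2 $$ (j, j)"
      using less.prems idx[of i j] by simp
    then have eq: "H1 $$ (i, j) = W $$ (i, j) * H2 $$ (j, j) + H2 $$ (i, j)"
      using less.prems W1[of i] by simp
    have "H1 $$ (j, j) = H2 $$ (j, j)" using diag[of j] W1[of j] less.prems by simp
    \<comment> \<open>Both entries are remainders modulo the same diagonal entry, so a multiple of
      it by which they differ must be 0.\<close>
    then have "\<bar>W $$ (i, j) * H2 $$ (j, j)\<bar> < H2 $$ (j, j)"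
      using R1[OF less.prems] R2[OF less.prems] eq by linarith
    then have "\<bar>W $$ (i, j)\<bar> * H2 $$ (j, j) < 1 * H2 $$ (j, j)"
      using P2[of j] less.prems by (simp add: abs_mult)
    then show ?case using P2[of j] less.prems by (subst (asm) mult_less_cancel_right) auto
  qed
  have "W = 1\<^sub>m n"
    using W upper lower W1 by (intro eq_matI) (auto, metis linorder_cases)
  then show ?thesis using eq C2 by simp
qed

section \<open>The greatest divisor\<close>

lemma pad_zero_cols_carrier [simp]:
  "N \<in> carrier_mat r c \<Longrightarrow> pad_zero_cols N k \<in> carrier_mat r (c + k)"
  by (auto simp: pad_zero_cols_def)

lemma pad_zero_cols_index:
  "N \<in> carrier_mat r c \<Longrightarrow> i < r \<Longrightarrow> j < c + k \<Longrightarrow>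
    pad_zero_cols N k $$ (i, j) = (if j < c then N $$ (i, j) else 0)"
  by (auto simp: pad_zero_cols_def)

lemma sum_lessThan_add_eq_zero:
  fixes f :: "nat \<Rightarrow> 'a :: comm_monoid_add"
  assumes "\<And>l. r \<le> l \<Longrightarrow> l < r + k \<Longrightarrow> f l = 0"
  shows "(\<Sum>l<r + k. f l) = (\<Sum>l<r. f l)"
  using assms by (intro sum.mono_neutral_right) auto

lemma mult_pad_zero_cols:
  fixes W N :: "int mat"
  assumes W: "W \<in> carrier_mat m r" and N: "N \<in> carrier_mat r c"
  shows "W * pad_zero_cols N k = pad_zero_cols (W * N) k"
proof (rule eq_matI)
  have WN: "W * N \<in> carrier_mat m c" using W N by simp
  fix i j assume "i < dim_row (pad_zero_cols (W * N) k)" "j < dim_col (pad_zero_cols (W * N) k)"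
  then have ij: "i < m" "j < c + k" using pad_zero_cols_carrier[OF WN, of k] by auto
  show "(W * pad_zero_cols N k) $$ (i, j) = pad_zero_cols (W * N) k $$ (i, j)"
    using ij index_mult_mat_sum[OF W pad_zero_cols_carrier[OF N] ij]
      index_mult_mat_sum[OF W N, of i j]
    by (simp add: pad_zero_cols_index[OF WN ij] pad_zero_cols_index[OF N _ ij(2)])
qed (use W N pad_zero_cols_carrier[OF N, of k] in \<open>auto simp: pad_zero_cols_def\<close>)

text \<open>Distinct columns in arbitrary order are a permutation of the increasing selection used
  by \<open>submatrix\<close>, so the determinants agree up to the sign \<open>s\<close>. The
  transpose is there because multilinearity is applied to rows.\<close>

lemma det_column_selection:
  fixes A :: "int mat"
  assumes A: "A \<in> carrier_mat r n" and f: "f \<in> {0..<r} \<rightarrow> {..<n}" and inj: "inj_on f {0..<r}"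
  obtains J s where "J \<subseteq> {..<n}" "card J = r"
    "det (mat\<^sub>r r r (\<lambda>i. row (transpose_mat A) (f i))) = s * det (submatrix A UNIV J)"
proof -
  define J where "J = f ` {0..<r}"
  have J: "J \<subseteq> {..<n}" "card J = r" "finite J"
    using f inj by (auto simp: J_def card_image)
  \<comment> \<open>The position of column \<open>f i\<close> in the increasing enumeration of
    \<open>J\<close>; outside the range \<open>p\<close> is the identity, as a permutation of
    \<open>{0..<r}\<close> has to be.\<close>
  define p where "p i = (if i < r then card {a \<in> J. a < f i} else i)" for i
  have p: "p i < r" "pick J (p i) = f i" if "i < r" for i
  proof -
    have fi: "f i \<in> J" using that by (simp add: J_def)
    then have "{a \<in> J. a < f i} \<subset> J" by auto
    then show "p i < r" using J(2,3) that by (auto simp: p_def dest: psubset_card_mono)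
    show "pick J (p i) = f i" using that fi by (simp add: p_def pick_card_in_set)
  qed
  have "inj_on p {0..<r}"
    using inj p(2) by (metis (no_types, lifting) atLeastLessThan_iff inj_on_def)
  moreover have "p \<in> {0..<r} \<rightarrow> {0..<r}" using p(1) by auto
  moreover have "\<forall>i. i \<notin> {0..<r} \<longrightarrow> p i = i" by (simp add: p_def)
  ultimately have perm: "p permutes {0..<r}"
    using inj_on_nat_permutes by blast
  define S where "S = submatrix A UNIV J"
  have rows: "{i. i < dim_row A \<and> i \<in> UNIV} = {..<r}" and cols: "{j. j < dim_col A \<and> j \<in> J} = J"
    using A J by auto
  have S: "S \<in> carrier_mat r r"
    unfolding S_def using A J cols by (intro carrier_matI) (auto simp: dim_submatrix)
  have S_index: "S $$ (i, j) = A $$ (i, pick J j)" if "i < r" "j < r" for i j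
    unfolding S_def using that A J rows cols by (subst submatrix_index) (auto simp: pick_UNIV)
  have "mat\<^sub>r r r (\<lambda>i. row (transpose_mat A) (f i)) = mat r r (\<lambda>(i, j). transpose_mat S $$ (p i, j))"
  proof (rule eq_matI)
    fix i j assume "i < dim_row (mat r r (\<lambda>(i, j). transpose_mat S $$ (p i, j)))"
      "j < dim_col (mat r r (\<lambda>(i, j). transpose_mat S $$ (p i, j)))"
    then have ij: "i < r" "j < r" by auto
    have "f i < n" using f ij by auto
    then show "mat\<^sub>r r r (\<lambda>i. row (transpose_mat A) (f i)) $$ (i, j) =
        mat r r (\<lambda>(i, j). transpose_mat S $$ (p i, j)) $$ (i, j)"
      using A S p[OF ij(1)] ij by (simp add: S_index)
  qed auto
  then have "det (mat\<^sub>r r r (\<lambda>i. row (transpose_mat A) (f i))) = signof p * det (transpose_mat S)"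
    using det_permute_rows[of "transpose_mat S" r p] perm S by simp
  then have "det (mat\<^sub>r r r (\<lambda>i. row (transpose_mat A) (f i))) = signof p * det S"
    by (simp add: det_transpose[OF S])
  then show ?thesis using that J unfolding S_def by blast
qed

text \<open>One half of the Cauchy-Binet formula: the determinant of \<open>A * P\<close> is an integer combination
  of the maximal minors of \<open>A\<close>.\<close>

lemma greatest_divisor_dvd_det_mult:
  assumes A: "A \<in> carrier_mat r n" and P: "P \<in> carrier_mat n r"
  shows "greatest_divisor A dvd det (A * P)"
proof -
  let ?At = "transpose_mat A" and ?Pt = "transpose_mat P"
  \<comment> \<open>A repeated column makes the determinant vanish; distinct columns give a multiple
    of a maximal minor.\<close>
  have minor: "greatest_divisor A dvd det (mat\<^sub>r r r (\<lambda>i. row ?At (f i)))"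
    if f: "f \<in> {0..<r} \<rightarrow> {..<n}" for f
  proof (cases "inj_on f {0..<r}")
    case True
    obtain J s where J: "J \<subseteq> {..<n}" "card J = r"
      and eq: "det (mat\<^sub>r r r (\<lambda>i. row ?At (f i))) = s * det (submatrix A UNIV J)"
      by (rule det_column_selection[OF A f True])
    have "greatest_divisor A dvd det (submatrix A UNIV J)"
      unfolding greatest_divisor_def using A J by (intro Gcd_dvd) auto
    then show ?thesis by (simp add: eq)
  next
    case False
    then obtain i j where ij: "i \<noteq> j" "i < r" "j < r" "f i = f j"
      by (auto simp: inj_on_def)
    let ?M = "mat\<^sub>r r r (\<lambda>i. row ?At (f i))"
    have "row ?M i = row ?M j" using ij by auto
    then have "det ?M = 0"
      using ij by (intro det_identical_rows[of ?M r i j]) auto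
    then show ?thesis by simp
  qed
  let ?a = "\<lambda>i j. ?Pt $$ (i, j) \<cdot>\<^sub>v row ?At j"
  let ?F = "{f. (\<forall>i\<in>{0..<r}. f i \<in> {0..<n}) \<and> (\<forall>i. i \<notin> {0..<r} \<longrightarrow> f i = i)}"
  have At: "?At \<in> carrier_mat n r" and Pt: "?Pt \<in> carrier_mat r n" using A P by auto
  have rows: "row ?At j \<in> carrier_vec r" for j using A by (auto simp: row_def)
  have AP: "A * P \<in> carrier_mat r r" using A P by simp
  \<comment> \<open>After transposition each row of the product is a combination of columns of
    \<open>A\<close>, with coefficients from \<open>P\<close>. Expanding all rows gives one term for
    each choice \<open>f\<close> of columns.\<close>
  have "det (A * P) = det (?Pt * ?At)"
    using det_transpose[OF AP] transpose_mult[OF A P] by simp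
  also have "\<dots> = det (mat\<^sub>r r r (\<lambda>i. finsum_vec TYPE(int) r (?a i) {0..<n}))"
    using mat_mul_finsum_alt[OF Pt At] by simp
  also have "\<dots> = (\<Sum>f\<in>?F. det (mat\<^sub>r r r (\<lambda>i. ?a i (f i))))"
    by (rule det_linear_rows_sum) (use rows in auto)
  also have "\<dots> = (\<Sum>f\<in>?F. (\<Prod>i\<in>{0..<r}. ?Pt $$ (i, f i)) * det (mat\<^sub>r r r (\<lambda>i. row ?At (f i))))"
    by (intro sum.cong refl det_rows_mul) (use rows in auto)
  finally have eq: "det (A * P) =
    (\<Sum>f\<in>?F. (\<Prod>i\<in>{0..<r}. ?Pt $$ (i, f i)) * det (mat\<^sub>r r r (\<lambda>i. row ?At (f i))))" .
  show ?thesis unfolding eq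
    by (intro dvd_sum dvd_mult minor) auto
qed

text \<open>Two divisibilities. \<open>N\<close> is \<open>A\<close> times the first
  \<open>r\<close> columns of \<open>U\<close>, selected by \<open>?P\<close>, so the gcd of the
  minors divides \<open>det N\<close>. Conversely \<open>A\<close> is [N O] times the inverse of
  \<open>U\<close>, so every maximal minor is \<open>det N\<close> times the determinant of an
  integral matrix \<open>Q\<close>.\<close>

lemma greatest_divisor_eq_det:
  assumes A: "A \<in> carrier_mat r (r + k)" and U: "unimodular (r + k) U"
    and N: "N \<in> carrier_mat r r" and AU: "A * U = pad_zero_cols N k"
  shows "greatest_divisor A = \<bar>det N\<bar>"
proof (rule zdvd_antisym_nonneg)
  let ?n = "r + k"
  let ?P = "mat ?n r (\<lambda>(i, j). if i = j then 1 else 0 :: int)"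
  have Uc: "U \<in> carrier_mat ?n ?n" by (rule unimodular_carrier[OF U])
  have P: "?P \<in> carrier_mat ?n r" by simp
  have "pad_zero_cols N k * ?P = N"
  proof (rule eq_matI)
    fix i j assume "i < dim_row N" "j < dim_col N"
    then have ij: "i < r" "j < r" using N by auto
    have "(pad_zero_cols N k * ?P) $$ (i, j) = (\<Sum>l<?n. if l = j then N $$ (i, j) else 0)"
      unfolding index_mult_mat_sum[OF pad_zero_cols_carrier[OF N] P ij]
      using ij by (intro sum.cong) (auto simp: pad_zero_cols_index[OF N])
    then show "(pad_zero_cols N k * ?P) $$ (i, j) = N $$ (i, j)" using ij by simp
  qed (use N in \<open>auto simp: pad_zero_cols_def\<close>)
  then have "N = A * (U * ?P)"
    using assoc_mult_mat[OF A Uc P] AU by simp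
  moreover have "greatest_divisor A dvd det (A * (U * ?P))"
    using Uc P by (intro greatest_divisor_dvd_det_mult[OF A]) simp
  ultimately show "greatest_divisor A dvd \<bar>det N\<bar>" by simp
  show "\<bar>det N\<bar> dvd greatest_divisor A"
    unfolding greatest_divisor_def
  proof (rule Gcd_greatest, clarify)
    fix J assume J: "J \<subseteq> {..<dim_col A}" "card J = dim_row A"
    obtain V where V: "unimodular ?n V" "U * V = 1\<^sub>m ?n" using unimodular_inverse[OF U] by blast
    have Vc: "V \<in> carrier_mat ?n ?n" by (rule unimodular_carrier[OF V(1)])
    have A_eq: "A = pad_zero_cols N k * V"
      using assoc_mult_mat[OF A Uc Vc] A AU V(2) by simp
    define Q where "Q = mat r r (\<lambda>(l, j). V $$ (l, pick J j))"
    have Q: "Q \<in> carrier_mat r r" by (simp add: Q_def)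
    have rows: "{i. i < dim_row A \<and> i \<in> UNIV} = {..<r}" and cols: "{j. j < dim_col A \<and> j \<in> J} = J"
      using A J by auto
    have pick: "pick J j < ?n" if "j < r" for j
      using pick_in_set[of j J] that J A by auto
    have "submatrix A UNIV J = N * Q"
    proof (rule eq_matI)
      fix i j assume "i < dim_row (N * Q)" "j < dim_col (N * Q)"
      then have ij: "i < r" "j < r" using N Q by auto
      have "submatrix A UNIV J $$ (i, j) = A $$ (i, pick J j)"
        using ij A J rows cols by (subst submatrix_index) (auto simp: pick_UNIV)
      also have "\<dots> = (\<Sum>l<?n. pad_zero_cols N k $$ (i, l) * V $$ (l, pick J j))"
        unfolding A_eq by (rule index_mult_mat_sum[OF pad_zero_cols_carrier[OF N] Vc ij(1) pick[OF ij(2)]])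
      also have "\<dots> = (\<Sum>l<r. pad_zero_cols N k $$ (i, l) * V $$ (l, pick J j))"
        using ij by (intro sum_lessThan_add_eq_zero) (simp add: pad_zero_cols_index[OF N])
      also have "\<dots> = (\<Sum>l<r. N $$ (i, l) * Q $$ (l, j))"
        using ij by (intro sum.cong) (auto simp: pad_zero_cols_index[OF N] Q_def)
      also have "\<dots> = (N * Q) $$ (i, j)"
        by (rule index_mult_mat_sum[OF N Q ij, symmetric])
      finally show "submatrix A UNIV J $$ (i, j) = (N * Q) $$ (i, j)" .
    qed (use A J N Q rows cols in \<open>auto simp: dim_submatrix\<close>)
    then show "\<bar>det N\<bar> dvd det (submatrix A UNIV J)"
      by (simp add: det_mult[OF N Q])
  qed
qed (auto simp: greatest_divisor_def)

section \<open>Counting extensions of a matrix in LHNF\<close>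

lemma prod_lessThan_add:
  fixes f :: "nat \<Rightarrow> 'a :: comm_monoid_mult"
  shows "(\<Prod>j<r + k. f j) = (\<Prod>j<r. f j) * (\<Prod>j<k. f (r + j))"
  by (induction k) (simp_all add: mult.assoc)

lemma card_mat_entries:
  assumes fin: "\<And>i j. i < m \<Longrightarrow> j < n \<Longrightarrow> finite (C i j)"
  shows "card {B \<in> carrier_mat m n. \<forall>i<m. \<forall>j<n. B $$ (i, j) \<in> C i j} = (\<Prod>i<m. \<Prod>j<n. card (C i j))"
    and "finite {B \<in> carrier_mat m n. \<forall>i<m. \<forall>j<n. B $$ (i, j) \<in> C i j}"
proof -
  let ?I = "{..<m} \<times> {..<n}" and ?S = "{B \<in> carrier_mat m n. \<forall>i<m. \<forall>j<n. B $$ (i, j) \<in> C i j}"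
  let ?F = "PiE ?I (\<lambda>(i, j). C i j)"
  have bij: "bij_betw (\<lambda>f. mat m n f) ?F ?S"
  proof (rule bij_betw_byWitness[where f' = "\<lambda>B. restrict (\<lambda>ij. B $$ ij) ?I"])
    show "\<forall>f\<in>?F. restrict (\<lambda>ij. mat m n f $$ ij) ?I = f"
      by (auto simp: fun_eq_iff PiE_def extensional_def)
    show "\<forall>B\<in>?S. mat m n (restrict (\<lambda>ij. B $$ ij) ?I) = B"
      by (auto intro!: eq_matI)
    show "mat m n ` ?F \<subseteq> ?S" by (auto simp: PiE_def Pi_def)
    show "(\<lambda>B. restrict (\<lambda>ij. B $$ ij) ?I) ` ?S \<subseteq> ?F"
      by (auto simp: PiE_def extensional_def)
  qed
  have "card ?S = card ?F" using bij_betw_same_card[OF bij] by simp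
  also have "\<dots> = (\<Prod>i<m. \<Prod>j<n. card (C i j))"
    by (simp add: card_PiE prod.cartesian_product case_prod_unfold)
  finally show "card ?S = (\<Prod>i<m. \<Prod>j<n. card (C i j))" .
  have "finite ?F" using fin by (intro finite_PiE) auto
  then show "finite ?S" using bij bij_betw_finite by blast
qed

text \<open>Of the rows with index below \<open>k\<close>, exactly \<open>k - Suc j\<close> come
  after row \<open>j\<close>; for \<open>j \<ge> k\<close> both sides are 1.\<close>

lemma prod_if_less_power:
  "(\<Prod>i<k. if j < i then x else 1) = (x :: nat) ^ (k - Suc j)"
proof (induction k)
  case (Suc k)
  then show ?case by (cases "j < k") (simp_all add: Suc_diff_Suc flip: power_Suc2)
qed simp

lemma append_rows_index:
  "A \<in> carrier_mat m n \<Longrightarrow> B \<in> carrier_mat k n \<Longrightarrow> i < m + k \<Longrightarrow> j < n \<Longrightarrow>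
    (A @\<^sub>r B) $$ (i, j) = (if i < m then A $$ (i, j) else B $$ (i - m, j))"
  by (auto simp: append_rows_def)

lemma prod_list_conv_prod_nth: "prod_list xs = (\<Prod>i<length xs. xs ! i)"
  by (induction xs) (simp_all add: prod.lessThan_Suc_shift del: prod.lessThan_Suc)

text \<open>The possible entries in position \<open>(i, j)\<close> of a block \<open>B\<close> such that \<open>[N O]\<close> above \<open>B\<close> is in LHNF
  with diagonal \<open>xs\<close> in the rows of \<open>B\<close>.\<close>

definition hnf_cell :: "int mat \<Rightarrow> nat \<Rightarrow> nat list \<Rightarrow> nat \<Rightarrow> nat \<Rightarrow> int set" where
  "hnf_cell N r xs i j =
    (if j < r then {0..<N $$ (j, j)}
     else if j < r + i then {0..<int (xs ! (j - r))}
     else if j = r + i then {int (xs ! i)} else {0})"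

lemma finite_hnf_cell: "finite (hnf_cell N r xs i j)"
  by (simp add: hnf_cell_def)

text \<open>In each of the \<open>k\<close> rows the first \<open>r\<close> cells contribute the
  diagonal product of \<open>N\<close>. For the other cells the product is rearranged by columns:
  the entry \<open>xs ! j\<close> bounds the \<open>k - Suc j\<close> cells below it.\<close>

lemma prod_card_hnf_cell:
  assumes N: "\<And>j. j < r \<Longrightarrow> 0 < N $$ (j, j)" and len: "length xs = k"
  shows "(\<Prod>i<k. \<Prod>j<r + k. card (hnf_cell N r xs i j)) =
    nat (\<Prod>j<r. N $$ (j, j)) ^ k * hnf_weight xs"
proof -
  have "(\<Prod>j<r + k. card (hnf_cell N r xs i j)) =
      nat (\<Prod>j<r. N $$ (j, j)) * (\<Prod>j<k. if j < i then xs ! j else 1)" for i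
  proof -
    have "int (\<Prod>j<r. card (hnf_cell N r xs i j)) = (\<Prod>j<r. N $$ (j, j))"
      using N by (simp add: hnf_cell_def less_imp_le)
    then have "(\<Prod>j<r. card (hnf_cell N r xs i j)) = nat (\<Prod>j<r. N $$ (j, j))"
      by (metis nat_int)
    moreover have "(\<Prod>j<k. card (hnf_cell N r xs i (r + j))) = (\<Prod>j<k. if j < i then xs ! j else 1)"
      by (intro prod.cong) (auto simp: hnf_cell_def)
    ultimately show ?thesis by (simp add: prod_lessThan_add)
  qed
  then have "(\<Prod>i<k. \<Prod>j<r + k. card (hnf_cell N r xs i j)) =
      nat (\<Prod>j<r. N $$ (j, j)) ^ k * (\<Prod>i<k. \<Prod>j<k. if j < i then xs ! j else 1)"
    by (simp add: prod.distrib)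
  also have "(\<Prod>i<k. \<Prod>j<k. if j < i then xs ! j else 1) = hnf_weight xs"
    by (subst prod.swap) (simp add: prod_if_less_power[simplified] hnf_weight_nth len)
  finally show ?thesis .
qed

text \<open>These are the \<open>B\<close> in the definition of fundamental solutions, with
  \<open>m\<close> in the role of d / delta(A).\<close>

definition hnf_blocks :: "int mat \<Rightarrow> nat \<Rightarrow> nat \<Rightarrow> nat \<Rightarrow> int mat set" where
  "hnf_blocks N r k m = {B \<in> carrier_mat k (r + k). LHNF (r + k) (pad_zero_cols N k @\<^sub>r B) \<and>
    (\<Prod>i\<in>{r..<r + k}. (pad_zero_cols N k @\<^sub>r B) $$ (i, i)) = int m}"

text \<open>The bounds in LHNF relate entries to each other through the diagonal. Once the diagonal
  \<open>xs\<close> is fixed they become independent conditions on single entries, so the set splits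
  into boxes that can be counted cell by cell.\<close>

lemma hnf_blocks_eq_Union:
  assumes N: "LHNF r N" and m: "m > 0"
  shows "hnf_blocks N r k m = (\<Union>xs\<in>diagonals k m.
    {B \<in> carrier_mat k (r + k). \<forall>i<k. \<forall>j<r + k. B $$ (i, j) \<in> hnf_cell N r xs i j})"
    (is "_ = (\<Union>xs\<in>_. ?S xs)")
proof -
  have Nc: "N \<in> carrier_mat r r" using N by (simp add: LHNF_def lower_triangular_pos_def)
  note Pc = pad_zero_cols_carrier[OF Nc, of k]
  have index: "(pad_zero_cols N k @\<^sub>r B) $$ (i, j) =
      (if i < r then if j < r then N $$ (i, j) else 0 else B $$ (i - r, j))"
    if "B \<in> carrier_mat k (r + k)" "i < r + k" "j < r + k" for B i j
    using append_rows_index[OF Pc that] that pad_zero_cols_index[OF Nc, of i j k] by simp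
  have diag: "(\<Prod>i\<in>{r..<r + k}. (pad_zero_cols N k @\<^sub>r B) $$ (i, i)) = (\<Prod>i<k. B $$ (i, r + i))"
    if "B \<in> carrier_mat k (r + k)" for B
    by (rule prod.reindex_bij_witness[of _ "\<lambda>i. r + i" "\<lambda>i. i - r"]) (auto simp: index[OF that])
  show ?thesis
  proof (intro equalityI subsetI)
    fix B assume "B \<in> hnf_blocks N r k m"
    then have B: "B \<in> carrier_mat k (r + k)" and H: "LHNF (r + k) (pad_zero_cols N k @\<^sub>r B)"
      and prod: "(\<Prod>i<k. B $$ (i, r + i)) = int m"
      by (auto simp: hnf_blocks_def diag)
    note HD = LHNF_D[OF H]
    have zero: "B $$ (i, j) = 0" if "i < k" "j < r + k" "r + i < j" for i j
      using HD(2)[of "r + i" j] that by (simp add: index[OF B])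
    have nonneg: "0 \<le> B $$ (i, j)" if "i < k" "j < r + k" for i j
      using HD(3)[of "r + i" j] that by (simp add: index[OF B])
    have pos: "0 < B $$ (i, r + i)" if "i < k" for i
      using HD(4)[of "r + i"] that by (simp add: index[OF B])
    have red: "B $$ (i, j) < (pad_zero_cols N k @\<^sub>r B) $$ (j, j)" if "i < k" "j < r + i" for i j
      using HD(5)[of j "r + i"] that by (simp add: index[OF B, of "r + i"])
    define xs where "xs = map (\<lambda>i. nat (B $$ (i, r + i))) [0..<k]"
    have xs: "length xs = k" "\<And>i. i < k \<Longrightarrow> int (xs ! i) = B $$ (i, r + i)"
      using pos by (auto simp: xs_def less_imp_le)
    have "int (prod_list xs) = (\<Prod>i<k. int (xs ! i))"
      by (simp add: prod_list_conv_prod_nth xs(1))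
    also have "\<dots> = int m" using xs(2) prod by simp
    finally have "xs \<in> diagonals k m" using xs(1) by (simp add: diagonals_def)
    moreover have "B $$ (i, j) \<in> hnf_cell N r xs i j" if ij: "i < k" "j < r + k" for i j
    proof -
      consider "j < r" | "r \<le> j" "j < r + i" | "j = r + i" | "r + i < j" by linarith
      then show ?thesis
      proof cases
        case 1
        then show ?thesis
          using nonneg[OF ij] red[of i j] ij by (simp add: hnf_cell_def index[OF B])
      next
        case 2
        then have "(pad_zero_cols N k @\<^sub>r B) $$ (j, j) = int (xs ! (j - r))"
          using xs(2)[of "j - r"] ij by (simp add: index[OF B])
        then show ?thesis
          using nonneg[OF ij] red[of i j] ij 2 by (simp add: hnf_cell_def)
      next
        case 3
        then show ?thesis using xs(2)[of i] ij by (simp add: hnf_cell_def)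
      next
        case 4
        then show ?thesis using zero[of i j] ij by (simp add: hnf_cell_def)
      qed
    qed
    ultimately show "B \<in> (\<Union>xs\<in>diagonals k m. ?S xs)" using B by blast
  next
    fix B assume "B \<in> (\<Union>xs\<in>diagonals k m. ?S xs)"
    then obtain xs where xs: "length xs = k" "prod_list xs = m"
      and B: "B \<in> carrier_mat k (r + k)"
      and cell: "\<And>i j. i < k \<Longrightarrow> j < r + k \<Longrightarrow> B $$ (i, j) \<in> hnf_cell N r xs i j"
      by (auto simp: diagonals_def)
    have diag_eq: "B $$ (i, r + i) = int (xs ! i)" if "i < k" for i
      using cell[of i "r + i"] that by (simp add: hnf_cell_def)
    have pos: "0 < xs ! i" if "i < k" for i
      using xs m that by (metis gr0I nth_mem prod_list_zero_iff)
    have "int (prod_list xs) = (\<Prod>i<k. int (xs ! i))"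
      by (simp add: prod_list_conv_prod_nth xs(1))
    then have prod: "(\<Prod>i<k. B $$ (i, r + i)) = int m" using xs(2) diag_eq by simp
    let ?M = "pad_zero_cols N k @\<^sub>r B"
    note ND = LHNF_D[OF N]
    have bounds: "(i < j \<longrightarrow> ?M $$ (i, j) = 0) \<and> 0 \<le> ?M $$ (i, j) \<and>
        (j < i \<longrightarrow> ?M $$ (i, j) < ?M $$ (j, j)) \<and> (i = j \<longrightarrow> 0 < ?M $$ (i, j))"
      if ij: "i < r + k" "j < r + k" for i j
    proof (cases "i < r")
      case True
      then show ?thesis
        using ij ND(2)[of i j] ND(3)[of i j] ND(4)[of i] ND(5)[of j i] by (auto simp: index[OF B])
    next
      case False
      have cell_ij: "B $$ (i - r, j) \<in> hnf_cell N r xs (i - r) j" using cell ij False by auto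
      consider "j < r" | "r \<le> j" "j < i" | "j = i" | "i < j" by linarith
      then show ?thesis
      proof cases
        case 2
        then show ?thesis
          using cell_ij False ij diag_eq[of "j - r"] by (simp add: index[OF B] hnf_cell_def)
      qed (use cell_ij False ij pos[of "i - r"] in \<open>simp_all add: index[OF B] hnf_cell_def\<close>)
    qed
    have "LHNF (r + k) (pad_zero_cols N k @\<^sub>r B)"
      unfolding LHNF_def lower_triangular_pos_def
      using bounds carrier_append_rows[OF Pc B] by blast
    then show "B \<in> hnf_blocks N r k m"
      using B prod diag[OF B] by (simp add: hnf_blocks_def)
  qed
qed

lemma card_hnf_blocks:
  assumes N: "LHNF r N" and m: "m > 0"
  shows "card (hnf_blocks N r k m) = nat (det N) ^ k * hnf_count k m"
proof -
  let ?S = "\<lambda>xs. {B \<in> carrier_mat k (r + k). \<forall>i<k. \<forall>j<r + k. B $$ (i, j) \<in> hnf_cell N r xs i j}"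
  have Nc: "N \<in> carrier_mat r r" and Npos: "\<And>j. j < r \<Longrightarrow> 0 < N $$ (j, j)"
    and Nz: "\<And>i j. i < j \<Longrightarrow> j < r \<Longrightarrow> N $$ (i, j) = 0"
    using N by (auto simp: LHNF_def lower_triangular_pos_def)
  note card_cells = card_mat_entries[of k "r + k" "hnf_cell N r xs" for xs, OF finite_hnf_cell]
  \<comment> \<open>The diagonal cells are singletons, so a matrix in a box determines
    \<open>xs\<close>.\<close>
  have disj: "?S xs \<inter> ?S ys = {}" if "xs \<in> diagonals k m" "ys \<in> diagonals k m" "xs \<noteq> ys" for xs ys
  proof (rule ccontr)
    assume "?S xs \<inter> ?S ys \<noteq> {}"
    then obtain B where B: "B \<in> ?S xs" "B \<in> ?S ys" by blast
    have "xs ! i = ys ! i" if "i < k" for i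
    proof -
      have "B $$ (i, r + i) \<in> hnf_cell N r xs i (r + i)" "B $$ (i, r + i) \<in> hnf_cell N r ys i (r + i)"
        using B that by auto
      then show ?thesis by (simp add: hnf_cell_def)
    qed
    then show False using that by (auto simp: diagonals_def intro: nth_equalityI)
  qed
  have "card (hnf_blocks N r k m) = (\<Sum>xs\<in>diagonals k m. card (?S xs))"
    unfolding hnf_blocks_eq_Union[OF assms]
  proof (rule card_UN_disjoint)
    show "finite (diagonals k m)" by (rule finite_diagonals[OF m])
    show "\<forall>xs\<in>diagonals k m. finite (?S xs)"
      by (intro ballI card_cells(2))
    show "\<forall>xs\<in>diagonals k m. \<forall>ys\<in>diagonals k m. xs \<noteq> ys \<longrightarrow> ?S xs \<inter> ?S ys = {}"
      by (intro ballI impI disj)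
  qed
  also have "\<dots> = (\<Sum>xs\<in>diagonals k m. nat (det N) ^ k * hnf_weight xs)"
  proof (rule sum.cong[OF refl])
    fix xs assume "xs \<in> diagonals k m"
    then have len: "length xs = k" by (simp add: diagonals_def)
    show "card (?S xs) = nat (det N) ^ k * hnf_weight xs"
      using card_cells(1)[of xs]
        prod_card_hnf_cell[of r N xs k] Npos len det_lower_triangular_prod[OF Nc Nz] by simp
  qed
  also have "\<dots> = nat (det N) ^ k * hnf_count k m"
    by (simp add: hnf_count_def sum_distrib_left)
  finally show ?thesis .
qed

section \<open>Equivalence classes of solutions\<close>

lemma append_rows_mult:
  fixes M X U :: "int mat"
  assumes M: "M \<in> carrier_mat m n" and X: "X \<in> carrier_mat k n" and U: "U \<in> carrier_mat n c"
  shows "(M @\<^sub>r X) * U = (M * U) @\<^sub>r (X * U)"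
proof (rule eq_matI)
  have MU: "M * U \<in> carrier_mat m c" and XU: "X * U \<in> carrier_mat k c" using M X U by auto
  fix i j assume "i < dim_row ((M * U) @\<^sub>r (X * U))" "j < dim_col ((M * U) @\<^sub>r (X * U))"
  then have ij: "i < m + k" "j < c" using carrier_append_rows[OF MU XU] by auto
  show "((M @\<^sub>r X) * U) $$ (i, j) = ((M * U) @\<^sub>r (X * U)) $$ (i, j)"
  proof (cases "i < m")
    case True
    then show ?thesis
      using index_mult_mat_sum[OF carrier_append_rows[OF M X] U ij] index_mult_mat_sum[OF M U, of i j] ij
      by (simp add: append_rows_index[OF MU XU] append_rows_index[OF M X])
  next
    case False
    then show ?thesis
      using index_mult_mat_sum[OF carrier_append_rows[OF M X] U ij] index_mult_mat_sum[OF X U, of "i - m" j] ij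
      by (simp add: append_rows_index[OF MU XU] append_rows_index[OF M X])
  qed
qed (use M X U in \<open>auto simp: append_rows_def\<close>)

text \<open>Used to act on the upper and on the lower rows of a stacked matrix
  independently.\<close>

definition block_diag :: "int mat \<Rightarrow> int mat \<Rightarrow> int mat" where
  "block_diag W V = four_block_mat W (0\<^sub>m (dim_row W) (dim_col V)) (0\<^sub>m (dim_row V) (dim_col W)) V"

lemma block_diag_mult_append_rows:
  assumes W: "W \<in> carrier_mat r r" and V: "V \<in> carrier_mat k k"
    and M: "M \<in> carrier_mat r n" and X: "X \<in> carrier_mat k n"
  shows "block_diag W V * (M @\<^sub>r X) = (W * M) @\<^sub>r (V * X)"
proof -
  have z: "0\<^sub>m r 0 \<in> carrier_mat r 0" "0\<^sub>m k 0 \<in> carrier_mat k 0"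
    "0\<^sub>m r k \<in> carrier_mat r k" "0\<^sub>m k r \<in> carrier_mat k r" by auto
  have "block_diag W V * (M @\<^sub>r X) =
    four_block_mat W (0\<^sub>m r k) (0\<^sub>m k r) V * four_block_mat M (0\<^sub>m r 0) X (0\<^sub>m k 0)"
    using W V M X by (simp add: block_diag_def append_rows_def)
  also have "\<dots> = four_block_mat (W * M + 0\<^sub>m r k * X) (W * 0\<^sub>m r 0 + 0\<^sub>m r k * 0\<^sub>m k 0)
      (0\<^sub>m k r * M + V * X) (0\<^sub>m k r * 0\<^sub>m r 0 + V * 0\<^sub>m k 0)"
    by (rule mult_four_block_mat[OF W z(3) z(4) V M z(1) X z(2)])
  also have "\<dots> = (W * M) @\<^sub>r (V * X)"
    unfolding append_rows_def using W V M X by (intro cong_four_block_mat) auto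
  finally show ?thesis .
qed

lemma unimodular_block_diag:
  assumes W: "unimodular r W" and V: "unimodular k V"
  shows "unimodular (r + k) (block_diag W V)"
proof -
  have Wc: "W \<in> carrier_mat r r" and Vc: "V \<in> carrier_mat k k"
    using W V unimodular_carrier by auto
  have "det (block_diag W V) = det W * det V"
    using Wc Vc unfolding block_diag_def
    by (subst det_four_block_mat_upper_right_zero[of _ r _ k]) auto
  then show ?thesis
    using W V four_block_carrier_mat[OF Wc Vc] by (auto simp: unimodular_def block_diag_def)
qed

section \<open>Equivalence under unimodular left multiplication\<close>

definition left_equiv :: "nat \<Rightarrow> int mat \<Rightarrow> int mat \<Rightarrow> bool" where
  "left_equiv n M M' \<longleftrightarrow> (\<exists>W. unimodular n W \<and> M = W * M')"

lemma left_equiv_refl: "M \<in> carrier_mat n c \<Longrightarrow> left_equiv n M M"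
  unfolding left_equiv_def using unimodular_one by (intro exI[of _ "1\<^sub>m n"]) auto

lemma left_equiv_sym:
  assumes "left_equiv n M M'" "M' \<in> carrier_mat n c"
  shows "left_equiv n M' M"
proof -
  obtain W where W: "unimodular n W" "M = W * M'" using assms(1) left_equiv_def by auto
  obtain V where V: "unimodular n V" "V * W = 1\<^sub>m n" using unimodular_inverse[OF W(1)] by blast
  have "V * M = (V * W) * M'"
    unfolding W(2) using assoc_mult_mat[of V n n W n M' c] W V assms(2) unimodular_carrier by auto
  then show ?thesis
    unfolding left_equiv_def using V assms(2) by (intro exI[of _ V]) auto
qed

lemma left_equiv_trans:
  assumes "left_equiv n M1 M2" "left_equiv n M2 M3" "M3 \<in> carrier_mat n c"
  shows "left_equiv n M1 M3"
proof -
  obtain W V where W: "unimodular n W" "M1 = W * M2" and V: "unimodular n V" "M2 = V * M3"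
    using assms(1,2) left_equiv_def by auto
  have "M1 = (W * V) * M3"
    unfolding W(2) V(2) using assoc_mult_mat[of W n n V n M3 c] W V assms(3) unimodular_carrier by auto
  then show ?thesis unfolding left_equiv_def using unimodular_mult[OF W(1) V(1)] by blast
qed

lemma left_equiv_mult_right:
  assumes "left_equiv n M M'" "M' \<in> carrier_mat n c" "U \<in> carrier_mat c d"
  shows "left_equiv n (M * U) (M' * U)"
proof -
  obtain W where W: "unimodular n W" "M = W * M'" using assms(1) left_equiv_def by auto
  then have "M * U = W * (M' * U)"
    using assoc_mult_mat[of W n n M' c U d] assms unimodular_carrier by auto
  then show ?thesis unfolding left_equiv_def using W by blast
qed

lemma card_quotient_transversal:
  assumes equiv: "equiv S R" and F: "F \<subseteq> S"
    and surj: "\<And>x. x \<in> S \<Longrightarrow> \<exists>y\<in>F. (x, y) \<in> R"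
    and inj: "\<And>x y. x \<in> F \<Longrightarrow> y \<in> F \<Longrightarrow> (x, y) \<in> R \<Longrightarrow> x = y"
  shows "card (S // R) = card F"
proof -
  have "bij_betw (\<lambda>x. R `` {x}) F (S // R)"
  proof (rule bij_betw_imageI)
    show "inj_on (\<lambda>x. R `` {x}) F"
      using inj F eq_equiv_class_iff[OF equiv] by (intro inj_onI) blast
    show "(\<lambda>x. R `` {x}) ` F = S // R"
    proof
      show "(\<lambda>x. R `` {x}) ` F \<subseteq> S // R" using F by (auto intro: quotientI)
      show "S // R \<subseteq> (\<lambda>x. R `` {x}) ` F"
      proof
        fix c assume "c \<in> S // R"
        then obtain x where x: "x \<in> S" "c = R `` {x}" by (auto elim: quotientE)
        then obtain y where y: "y \<in> F" "(x, y) \<in> R" using surj by blast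
        then have "c = R `` {y}" using equiv_class_eq[OF equiv] x by simp
        then show "c \<in> (\<lambda>x. R `` {x}) ` F" using y by blast
      qed
    qed
  qed
  then show ?thesis using bij_betw_same_card by metis
qed

text \<open>The common ground of an arbitrary reducing pair and of the pair constructed in
  \<open>row_reduction_exists\<close>, so that the counts are proved once for both.\<close>

locale row_reduction =
  fixes A U U' N :: "int mat" and r k :: nat
  assumes A: "A \<in> carrier_mat r (r + k)" and U: "unimodular (r + k) U" and U': "unimodular r U'"
    and N: "LHNF r N" and reduced: "U' * A * U = pad_zero_cols N k"
begin

abbreviation "n \<equiv> r + k"

definition V :: "int mat" where
  "V = (SOME V. unimodular n V \<and> U * V = 1\<^sub>m n \<and> V * U = 1\<^sub>m n)"

lemma V: "unimodular n V" "U * V = 1\<^sub>m n" "V * U = 1\<^sub>m n"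
proof -
  have "\<exists>V. unimodular n V \<and> U * V = 1\<^sub>m n \<and> V * U = 1\<^sub>m n"
    using unimodular_inverse[OF U] by metis
  from someI_ex[OF this] show "unimodular n V" "U * V = 1\<^sub>m n" "V * U = 1\<^sub>m n"
    unfolding V_def by auto
qed

lemma carriers: "U \<in> carrier_mat n n" "V \<in> carrier_mat n n" "U' \<in> carrier_mat r r" "N \<in> carrier_mat r r"
  using U U' V(1) N LHNF_D(1) unimodular_carrier by auto

lemma det_N: "det N = (\<Prod>i<r. N $$ (i, i))"
  using LHNF_D(2)[OF N] by (rule det_lower_triangular_prod[OF carriers(4)])

lemma det_N_pos: "0 < det N"
  unfolding det_N by (rule prod_pos) (use LHNF_D(4)[OF N] in auto)

lemma greatest_divisor_eq: "greatest_divisor A = det N"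
proof -
  obtain W where W: "unimodular r W" "W * U' = 1\<^sub>m r" using unimodular_inverse[OF U'] by blast
  have Wc: "W \<in> carrier_mat r r" by (rule unimodular_carrier[OF W(1)])
  \<comment> \<open>Undoing \<open>U'\<close> yields [W * N O], whose left block has the same
    determinant as \<open>N\<close> up to sign.\<close>
  have "A * U = (W * U') * (A * U)" unfolding W(2) using A carriers by simp
  also have "\<dots> = W * (U' * (A * U))"
    using assoc_mult_mat[of W r r U' r "A * U" n] Wc A carriers by simp
  also have "U' * (A * U) = pad_zero_cols N k"
    using assoc_mult_mat[of U' r r A n U n] A carriers reduced by simp
  also have "W * pad_zero_cols N k = pad_zero_cols (W * N) k"
    by (rule mult_pad_zero_cols[OF Wc carriers(4)])
  finally have "greatest_divisor A = \<bar>det (W * N)\<bar>"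
    using Wc carriers by (intro greatest_divisor_eq_det[OF A U]) auto
  then show ?thesis
    using W(1) det_N_pos by (auto simp: det_mult[OF Wc carriers(4)] unimodular_def)
qed

lemma U_V_cancel:
  assumes "X \<in> carrier_mat m n"
  shows "X * U * V = X" "X * V * U = X"
  using assms carriers V assoc_mult_mat[of X m n U n V n] assoc_mult_mat[of X m n V n U n] by auto

text \<open>Right multiplication by \<open>U\<close> is undone by \<open>V\<close> and does not
  interfere with left factors; passing from \<open>A * U\<close> to [N O] is itself a unimodular
  left multiplication, by the block diagonal matrix of \<open>U'\<close> and the identity.\<close>

lemma left_equiv_iff:
  assumes X: "X1 \<in> carrier_mat k n" "X2 \<in> carrier_mat k n"
  shows "LA_equiv A X1 X2 \<longleftrightarrow>
    left_equiv n (pad_zero_cols N k @\<^sub>r (X1 * U)) (pad_zero_cols N k @\<^sub>r (X2 * U))"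
proof -
  let ?T = "\<lambda>X. pad_zero_cols N k @\<^sub>r (X * U)"
  have c: "A @\<^sub>r X \<in> carrier_mat n n" "(A @\<^sub>r X) * U \<in> carrier_mat n n" "?T X \<in> carrier_mat n n"
    if X: "X \<in> carrier_mat k n" for X
  proof -
    show "A @\<^sub>r X \<in> carrier_mat n n" by (rule carrier_append_rows[OF A X])
    then show "(A @\<^sub>r X) * U \<in> carrier_mat n n" by (rule mult_carrier_mat[OF _ carriers(1)])
    show "?T X \<in> carrier_mat n n"
      by (rule carrier_append_rows[OF pad_zero_cols_carrier[OF carriers(4)] mult_carrier_mat[OF X carriers(1)]])
  qed
  have T: "left_equiv n (?T X) ((A @\<^sub>r X) * U)" if X: "X \<in> carrier_mat k n" for X
  proof -
    have "block_diag U' (1\<^sub>m k) * ((A @\<^sub>r X) * U) = block_diag U' (1\<^sub>m k) * ((A * U) @\<^sub>r (X * U))"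
      by (simp add: append_rows_mult[OF A X carriers(1)])
    also have "\<dots> = (U' * (A * U)) @\<^sub>r (1\<^sub>m k * (X * U))"
      using A X carriers by (intro block_diag_mult_append_rows) auto
    also have "U' * (A * U) = pad_zero_cols N k"
      using assoc_mult_mat[of U' r r A n U n] A carriers reduced by simp
    finally have "?T X = block_diag U' (1\<^sub>m k) * ((A @\<^sub>r X) * U)"
      using X carriers by simp
    then show ?thesis
      unfolding left_equiv_def using unimodular_block_diag[OF U' unimodular_one] by blast
  qed
  have "LA_equiv A X1 X2 \<longleftrightarrow> left_equiv n (A @\<^sub>r X1) (A @\<^sub>r X2)"
    using A by (simp add: LA_equiv_def left_equiv_def)
  also have "\<dots> \<longleftrightarrow> left_equiv n ((A @\<^sub>r X1) * U) ((A @\<^sub>r X2) * U)"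
  proof
    assume "left_equiv n (A @\<^sub>r X1) (A @\<^sub>r X2)"
    then show "left_equiv n ((A @\<^sub>r X1) * U) ((A @\<^sub>r X2) * U)"
      by (rule left_equiv_mult_right[OF _ c(1)[OF X(2)] carriers(1)])
  next
    assume "left_equiv n ((A @\<^sub>r X1) * U) ((A @\<^sub>r X2) * U)"
    then have "left_equiv n ((A @\<^sub>r X1) * U * V) ((A @\<^sub>r X2) * U * V)"
      by (rule left_equiv_mult_right[OF _ c(2)[OF X(2)] carriers(2)])
    then show "left_equiv n (A @\<^sub>r X1) (A @\<^sub>r X2)"
      by (simp only: U_V_cancel(1)[OF c(1)[OF X(1)]] U_V_cancel(1)[OF c(1)[OF X(2)]])
  qed
  also have "\<dots> \<longleftrightarrow> left_equiv n (?T X1) (?T X2)"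
  proof
    assume "left_equiv n ((A @\<^sub>r X1) * U) ((A @\<^sub>r X2) * U)"
    then have "left_equiv n (?T X1) ((A @\<^sub>r X2) * U)"
      using T[OF X(1)] c(2)[OF X(2)] left_equiv_trans by blast
    then show "left_equiv n (?T X1) (?T X2)"
      using left_equiv_sym[OF T[OF X(2)] c(2)[OF X(2)]] c(3)[OF X(2)] left_equiv_trans by blast
  next
    assume "left_equiv n (?T X1) (?T X2)"
    then have "left_equiv n (?T X1) ((A @\<^sub>r X2) * U)"
      using T[OF X(2)] c(2)[OF X(2)] left_equiv_trans by blast
    then show "left_equiv n ((A @\<^sub>r X1) * U) ((A @\<^sub>r X2) * U)"
      using left_equiv_sym[OF T[OF X(1)] c(2)[OF X(1)]] c(2)[OF X(2)] left_equiv_trans by blast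
  qed
  finally show ?thesis .
qed

lemma abs_det_transform:
  assumes X: "X \<in> carrier_mat k n"
  shows "\<bar>det (pad_zero_cols N k @\<^sub>r (X * U))\<bar> = \<bar>det (A @\<^sub>r X)\<bar>"
proof -
  have AX: "A @\<^sub>r X \<in> carrier_mat n n" using A X by auto
  have "(U' * A * U) @\<^sub>r (X * U) = ((U' * A) @\<^sub>r X) * U"
    using A X carriers by (intro append_rows_mult[symmetric]) auto
  also have "(U' * A) @\<^sub>r X = block_diag U' (1\<^sub>m k) * (A @\<^sub>r X)"
    using A X carriers by (subst block_diag_mult_append_rows) auto
  finally have "pad_zero_cols N k @\<^sub>r (X * U) = block_diag U' (1\<^sub>m k) * (A @\<^sub>r X) * U"
    unfolding reduced .
  moreover have "unimodular n (block_diag U' (1\<^sub>m k))"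
    using unimodular_block_diag[OF U' unimodular_one] by simp
  ultimately show ?thesis
    using U AX by (auto simp: unimodular_def det_mult[where n = n] abs_mult)
qed

lemma det_hnf_block:
  assumes "B \<in> hnf_blocks N r k m"
  shows "det (pad_zero_cols N k @\<^sub>r B) = det N * int m"
proof -
  let ?M = "pad_zero_cols N k @\<^sub>r B"
  have B: "B \<in> carrier_mat k n" and H: "LHNF n ?M" and prod: "(\<Prod>i\<in>{r..<n}. ?M $$ (i, i)) = int m"
    using assms by (auto simp: hnf_blocks_def)
  have "det ?M = (\<Prod>i<n. ?M $$ (i, i))"
    using LHNF_D(1,2)[OF H] by (rule det_lower_triangular_prod)
  also have "\<dots> = (\<Prod>i<r. ?M $$ (i, i)) * (\<Prod>i\<in>{r..<n}. ?M $$ (i, i))"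
    using prod.atLeastLessThan_concat[of 0 r n "\<lambda>i. ?M $$ (i, i)"] by (simp add: atLeast0LessThan)
  also have "(\<Prod>i<r. ?M $$ (i, i)) = det N"
    unfolding det_N using pad_zero_cols_carrier[OF carriers(4), of k] B
    by (intro prod.cong) (auto simp: append_rows_index pad_zero_cols_index[OF carriers(4)])
  finally show ?thesis using prod by simp
qed

text \<open>Row operations on the lower \<open>k\<close> rows alone make the right block of
  \<open>Y\<close> lower triangular. As the block above it is zero, the whole matrix is then lower
  triangular, and the reduction below the diagonal can be done without touching [N O].\<close>

lemma ex_hnf_block:
  assumes Y: "Y \<in> carrier_mat k n" and det: "\<bar>det (pad_zero_cols N k @\<^sub>r Y)\<bar> = det N * int m"
    and m: "m > 0"
  shows "\<exists>B\<in>hnf_blocks N r k m. left_equiv n (pad_zero_cols N k @\<^sub>r B) (pad_zero_cols N k @\<^sub>r Y)"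
proof -
  note Nc = carriers(4) and ND = LHNF_D[OF N]
  note Pc = pad_zero_cols_carrier[OF Nc, of k]
  let ?right = "\<lambda>Y. mat k k (\<lambda>(i, j). Y $$ (i, r + j))"
  obtain V2 where V2: "unimodular k V2"
    and Z: "\<forall>i<k. \<forall>j<k. i < j \<longrightarrow> (V2 * ?right Y) $$ (i, j) = 0"
    and NN: "\<forall>i<k. 0 \<le> (V2 * ?right Y) $$ (i, i)"
    using ex_unimodular_left_lower_triangular_nonneg[of "?right Y" k] by auto
  have V2c: "V2 \<in> carrier_mat k k" by (rule unimodular_carrier[OF V2])
  have V2Y: "V2 * Y \<in> carrier_mat k n" using V2c Y by simp
  have right: "V2 * ?right Y = ?right (V2 * Y)"
  proof (rule eq_matI)
    fix i j assume "i < dim_row (?right (V2 * Y))" "j < dim_col (?right (V2 * Y))"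
    then have ij: "i < k" "j < k" by auto
    then show "(V2 * ?right Y) $$ (i, j) = ?right (V2 * Y) $$ (i, j)"
      using index_mult_mat_sum[OF V2c Y, of i "r + j"] index_mult_mat_sum[OF V2c, of "?right Y" k i j]
      by simp
  qed (use V2c in auto)
  define T where "T = pad_zero_cols N k @\<^sub>r (V2 * Y)"
  have T: "T \<in> carrier_mat n n" unfolding T_def using Pc V2Y by auto
  have T_index: "T $$ (i, j) = (if i < r then if j < r then N $$ (i, j) else 0 else (V2 * Y) $$ (i - r, j))"
    if "i < n" "j < n" for i j
    using that by (simp add: T_def append_rows_index[OF Pc V2Y] pad_zero_cols_index[OF Nc])
  have T_right: "T $$ (i, j) = (V2 * ?right Y) $$ (i - r, j - r)" if "r \<le> i" "i < n" "r \<le> j" "j < n" for i j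
    using that by (simp add: right T_index)
  have T_eq: "T = block_diag (1\<^sub>m r) V2 * (pad_zero_cols N k @\<^sub>r Y)"
    using block_diag_mult_append_rows[OF one_carrier_mat V2c Pc Y] Pc by (simp add: T_def)
  have uD: "unimodular n (block_diag (1\<^sub>m r) V2)" by (rule unimodular_block_diag[OF unimodular_one V2])
  have T_zero: "T $$ (i, j) = 0" if "i < j" "j < n" for i j
  proof (cases "i < r")
    case True
    then show ?thesis using that ND(2)[of i j] by (simp add: T_index)
  next
    case False
    then show ?thesis using that Z by (simp add: T_right)
  qed
  have "\<bar>det T\<bar> = \<bar>det (pad_zero_cols N k @\<^sub>r Y)\<bar>"
    unfolding T_eq using uD carrier_append_rows[OF Pc Y]
    by (auto simp: unimodular_def det_mult[where n = n] abs_mult)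
  then have det_T: "\<bar>\<Prod>i<n. T $$ (i, i)\<bar> = det N * int m"
    using det det_lower_triangular_prod[OF T T_zero] by simp
  \<comment> \<open>A nonzero determinant excludes zeros on the diagonal, so nonnegativity already
    makes it positive.\<close>
  have "0 < det N * int m" using det_N_pos m by simp
  then have "0 < \<bar>\<Prod>i<n. T $$ (i, i)\<bar>" unfolding det_T .
  then have T_nz: "T $$ (i, i) \<noteq> 0" if "i < n" for i using that by auto
  have T_nonneg: "0 \<le> T $$ (i, i)" if "i < n" for i
  proof (cases "i < r")
    case True
    then show ?thesis using that ND(4)[of i] by (simp add: T_index)
  next
    case False
    then show ?thesis using that NN by (simp add: T_right)
  qed
  have T_pos: "0 < T $$ (i, i)" if "i < n" for i using T_nz[OF that] T_nonneg[OF that] by linarith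
  have T_red: "0 \<le> T $$ (i, j) \<and> T $$ (i, j) < T $$ (j, j)" if "i < r" "j < i" for i j
    using that ND(3)[of i j] ND(5)[of j i] by (simp add: T_index)
  obtain W where W: "unimodular n W" and H: "LHNF n (W * T)"
    and diag: "\<forall>i<n. (W * T) $$ (i, i) = T $$ (i, i)"
    and top: "\<forall>i<r. \<forall>j<n. i < n \<longrightarrow> (W * T) $$ (i, j) = T $$ (i, j)"
    using ex_unimodular_LHNF[of T n r, OF T T_zero T_pos T_red] by blast
  define B where "B = mat k n (\<lambda>(i, j). (W * T) $$ (r + i, j))"
  have B: "B \<in> carrier_mat k n" by (simp add: B_def)
  have B_index: "B $$ (i - r, j) = (W * T) $$ (i, j)" if "r \<le> i" "i < n" "j < n" for i j
    using that by (simp add: B_def)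
  have eq: "pad_zero_cols N k @\<^sub>r B = W * T"
  proof (rule eq_matI)
    fix i j assume "i < dim_row (W * T)" "j < dim_col (W * T)"
    then have ij: "i < n" "j < n" using LHNF_D(1)[OF H] by auto
    then show "(pad_zero_cols N k @\<^sub>r B) $$ (i, j) = (W * T) $$ (i, j)"
      using top B_index[of i j]
      by (simp add: append_rows_index[OF Pc B] pad_zero_cols_index[OF Nc] T_index)
  qed (use carrier_append_rows[OF Pc B] LHNF_D(1)[OF H] in auto)
  have "(\<Prod>i<n. T $$ (i, i)) = (\<Prod>i<r. T $$ (i, i)) * (\<Prod>i\<in>{r..<n}. T $$ (i, i))"
    using prod.atLeastLessThan_concat[of 0 r n "\<lambda>i. T $$ (i, i)"] by (simp add: atLeast0LessThan)
  also have "(\<Prod>i<r. T $$ (i, i)) = det N" unfolding det_N by (simp add: T_index)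
  finally have "\<bar>det N * (\<Prod>i\<in>{r..<n}. T $$ (i, i))\<bar> = det N * int m" using det_T by simp
  moreover have "0 < (\<Prod>i\<in>{r..<n}. T $$ (i, i))" by (rule prod_pos) (use T_pos in auto)
  ultimately have "(\<Prod>i\<in>{r..<n}. T $$ (i, i)) = int m" using det_N_pos by (simp add: abs_mult)
  then have "B \<in> hnf_blocks N r k m" using B H diag by (simp add: hnf_blocks_def eq)
  moreover have "left_equiv n (W * T) (pad_zero_cols N k @\<^sub>r Y)"
  proof -
    have "W * T = (W * block_diag (1\<^sub>m r) V2) * (pad_zero_cols N k @\<^sub>r Y)"
      unfolding T_eq
      using assoc_mult_mat[of W n n "block_diag (1\<^sub>m r) V2" n "pad_zero_cols N k @\<^sub>r Y" n]
        unimodular_carrier[OF W] unimodular_carrier[OF uD] carrier_append_rows[OF Pc Y] by simp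
    then show ?thesis unfolding left_equiv_def using unimodular_mult[OF W uD] by blast
  qed
  ultimately show ?thesis unfolding eq[symmetric] by blast
qed

lemma fundamental_solutions_eq:
  assumes "d = det N * int m"
  shows "fundamental_solutions A d U U' = (\<lambda>B. B * V) ` hnf_blocks N r k m"
proof -
  have "inv\<^bsub>ring_mat TYPE(int) n ()\<^esub> U = V"
  proof -
    interpret ring "ring_mat TYPE(int) n ()" by (rule ring_mat)
    show ?thesis by (rule inv_char) (use carriers V in \<open>auto simp: ring_mat_simps\<close>)
  qed
  moreover have "d div greatest_divisor A = int m"
    using assms det_N_pos by (simp add: greatest_divisor_eq)
  moreover have "dim_row A = r" "dim_col A = n" using A by auto
  ultimately show ?thesis
    by (auto simp: fundamental_solutions_def hnf_blocks_def Let_def reduced image_iff)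
qed

lemma card_fundamental_solutions:
  assumes "d = det N * int m" "m > 0"
  shows "card (fundamental_solutions A d U U') = nat (det N) ^ k * hnf_count k m"
proof -
  have "inj_on (\<lambda>B. B * V) (hnf_blocks N r k m)"
    by (rule inj_on_inverseI[of _ "\<lambda>X. X * U"]) (auto simp: hnf_blocks_def U_V_cancel)
  then show ?thesis
    using card_hnf_blocks[OF N assms(2)] by (simp add: fundamental_solutions_eq[OF assms(1)] card_image)
qed

text \<open>The fundamental solutions are a transversal of the classes: \<open>ex_hnf_block\<close>
  puts one into every class, and \<open>LHNF_unique\<close> shows that no class contains
  two.\<close>

lemma card_LA_classes:
  assumes d: "d = det N * int m" and m: "m > 0"
  shows "card (LA_classes A d) = card (fundamental_solutions A d U U')"
  unfolding LA_classes_def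
proof (rule card_quotient_transversal)
  let ?P = "pad_zero_cols N k"
  have dims: "dim_row A = r" "dim_col A = n" using A by auto
  have d_pos: "0 < d" using d m det_N_pos by simp
  have sol: "X \<in> solutions A d \<longleftrightarrow> X \<in> carrier_mat k n \<and> \<bar>det (A @\<^sub>r X)\<bar> = d" for X
    using d_pos dims by (auto simp: solutions_def abs_if)
  have equiv_iff: "LA_equiv A X1 X2 \<longleftrightarrow> left_equiv n (A @\<^sub>r X1) (A @\<^sub>r X2)" for X1 X2
    using dims by (simp add: LA_equiv_def left_equiv_def)
  have AX: "A @\<^sub>r X \<in> carrier_mat n n" if "X \<in> solutions A d" for X
    using that A sol by auto
  show "equiv (solutions A d) {(X1, X2). X1 \<in> solutions A d \<and> X2 \<in> solutions A d \<and> LA_equiv A X1 X2}"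
    unfolding equiv_iff
    by (rule equivI)
      (auto simp: refl_on_def sym_def trans_def intro: left_equiv_refl[OF AX] left_equiv_sym[OF _ AX]
        left_equiv_trans[OF _ _ AX])
  show fund: "fundamental_solutions A d U U' \<subseteq> solutions A d"
  proof
    fix X assume "X \<in> fundamental_solutions A d U U'"
    then obtain B where B: "B \<in> hnf_blocks N r k m" "X = B * V"
      by (auto simp: fundamental_solutions_eq[OF d])
    then have Bc: "B \<in> carrier_mat k n" by (simp add: hnf_blocks_def)
    then have "X \<in> carrier_mat k n" "X * U = B" using B carriers U_V_cancel by auto
    then have "\<bar>det (A @\<^sub>r X)\<bar> = \<bar>d\<bar>"
      using abs_det_transform[of X] det_hnf_block[OF B(1)] d by simp
    then show "X \<in> solutions A d"
      using sol \<open>X \<in> carrier_mat k n\<close> d_pos by simp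
  qed
  show "\<exists>Y\<in>fundamental_solutions A d U U'.
      (X, Y) \<in> {(X1, X2). X1 \<in> solutions A d \<and> X2 \<in> solutions A d \<and> LA_equiv A X1 X2}"
    if X: "X \<in> solutions A d" for X
  proof -
    have Xc: "X \<in> carrier_mat k n" using X sol by simp
    have "\<bar>det (?P @\<^sub>r (X * U))\<bar> = det N * int m"
      using abs_det_transform[OF Xc] X sol d by simp
    then obtain B where B: "B \<in> hnf_blocks N r k m" and eq: "left_equiv n (?P @\<^sub>r B) (?P @\<^sub>r (X * U))"
      using ex_hnf_block[of "X * U" m] Xc carriers m by auto
    have Bc: "B \<in> carrier_mat k n" using B by (simp add: hnf_blocks_def)
    have BV: "B * V \<in> fundamental_solutions A d U U'"
      using B by (auto simp: fundamental_solutions_eq[OF d])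
    have "LA_equiv A (B * V) X"
      using left_equiv_iff[of "B * V" X] Bc Xc carriers eq U_V_cancel(2)[OF Bc] by simp
    then have "LA_equiv A X (B * V)"
      unfolding equiv_iff by (rule left_equiv_sym[OF _ AX[OF X]])
    then show ?thesis using BV fund X by blast
  qed
  show "X = Y" if fXY: "X \<in> fundamental_solutions A d U U'" "Y \<in> fundamental_solutions A d U U'"
    and rel: "(X, Y) \<in> {(X1, X2). X1 \<in> solutions A d \<and> X2 \<in> solutions A d \<and> LA_equiv A X1 X2}" for X Y
  proof -
    obtain B C where B: "B \<in> hnf_blocks N r k m" "X = B * V" and C: "C \<in> hnf_blocks N r k m" "Y = C * V"
      using fXY by (auto simp: fundamental_solutions_eq[OF d])
    have c: "B \<in> carrier_mat k n" "C \<in> carrier_mat k n" using B C by (auto simp: hnf_blocks_def)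
    have "left_equiv n (?P @\<^sub>r B) (?P @\<^sub>r C)"
    proof -
      have "X \<in> carrier_mat k n" "Y \<in> carrier_mat k n" using B C c carriers by auto
      moreover have "X * U = B" "Y * U = C" unfolding B(2) C(2) using U_V_cancel(2) c by blast+
      ultimately show ?thesis using rel left_equiv_iff[of X Y] by simp
    qed
    then have eq: "?P @\<^sub>r B = ?P @\<^sub>r C"
      using B C LHNF_unique unfolding left_equiv_def hnf_blocks_def by blast
    have "B = C"
    proof (rule eq_matI)
      fix i j assume "i < dim_row C" "j < dim_col C"
      then have "i < k" "j < n" using c by auto
      then show "B $$ (i, j) = C $$ (i, j)"
        using arg_cong[OF eq, of "\<lambda>M. M $$ (r + i, j)"]
          append_rows_index[OF pad_zero_cols_carrier[OF carriers(4), of k] c(1), of "r + i" j]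
          append_rows_index[OF pad_zero_cols_carrier[OF carriers(4), of k] c(2), of "r + i" j] by simp
    qed (use c in auto)
    then show ?thesis using B C by simp
  qed
qed

end

text \<open>Column operations give [L O] with \<open>L\<close> lower triangular and nonnegative on
  the diagonal. Up to sign \<open>det L\<close> is the greatest divisor, which is nonzero, so the
  diagonal is positive and row operations bring \<open>L\<close> into LHNF.\<close>

lemma row_reduction_exists:
  assumes A: "A \<in> carrier_mat r (r + k)" and nz: "greatest_divisor A \<noteq> 0"
  shows "\<exists>U U' N. row_reduction A U U' N r k"
proof -
  let ?n = "r + k"
  obtain U where U: "unimodular ?n U"
    and Z: "\<forall>i<r. \<forall>j<?n. i < j \<longrightarrow> (A * U) $$ (i, j) = 0"
    and NN: "\<forall>i<r. i < ?n \<longrightarrow> 0 \<le> (A * U) $$ (i, i)"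
    using ex_unimodular_lower_triangular_nonneg[OF A] by blast
  have Uc: "U \<in> carrier_mat ?n ?n" by (rule unimodular_carrier[OF U])
  define L where "L = mat r r (\<lambda>(i, j). (A * U) $$ (i, j))"
  have L: "L \<in> carrier_mat r r" by (simp add: L_def)
  have L_zero: "L $$ (i, j) = 0" if "i < j" "j < r" for i j using that Z by (simp add: L_def)
  have AU: "A * U = pad_zero_cols L k"
  proof (rule eq_matI)
    fix i j assume "i < dim_row (pad_zero_cols L k)" "j < dim_col (pad_zero_cols L k)"
    then have "i < r" "j < ?n" using pad_zero_cols_carrier[OF L, of k] by auto
    then show "(A * U) $$ (i, j) = pad_zero_cols L k $$ (i, j)"
      using Z by (simp add: pad_zero_cols_index[OF L]) (simp add: L_def)
  qed (use A Uc pad_zero_cols_carrier[OF L, of k] in auto)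
  have "det L \<noteq> 0" using greatest_divisor_eq_det[OF A U L AU] nz by simp
  then have "(\<Prod>i<r. L $$ (i, i)) \<noteq> 0" using det_lower_triangular_prod[OF L L_zero] by simp
  then have L_pos: "0 < L $$ (i, i)" if "i < r" for i
    using that NN by (force simp: L_def order_less_le)
  \<comment> \<open>With 0 as the number of prescribed rows, every row may be reduced.\<close>
  obtain W where W: "unimodular r W" "LHNF r (W * L)"
    using ex_unimodular_LHNF[OF L L_zero L_pos, of 0] by auto
  have Wc: "W \<in> carrier_mat r r" by (rule unimodular_carrier[OF W(1)])
  have "W * A * U = pad_zero_cols (W * L) k"
    using assoc_mult_mat[OF Wc A Uc] AU mult_pad_zero_cols[OF Wc L] by simp
  then have "row_reduction A U W (W * L) r k"
    using A U W by unfold_locales auto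
  then show ?thesis by blast
qed

theorem theorem5p4:
  fixes A :: "int mat" and r n k l :: nat and d :: int
    and p e :: "nat \<Rightarrow> nat"
  assumes "A \<in> carrier_mat r n"
    and "r < n"
    and "full_row_rank A"
    and "k = n - r"
    and "0 < d"
    and "greatest_divisor A dvd d"
    and "\<And>i. i \<in> {1..l} \<Longrightarrow> prime (p i)"
    and "inj_on p {1..l}"
    and "\<And>i. i \<in> {1..l} \<Longrightarrow> 1 \<le> e i"
    and "d = (\<Prod>i=1..l. int (p i) ^ e i) * greatest_divisor A"
  shows "let N = greatest_divisor A ^ k *
               (\<Prod>i=1..l. \<Sum>js\<in>index_sequences (e i) k. int (p i) ^ (e i * k - sum_list js))
         in (\<forall>U U'. reducing_pair A U U' \<longrightarrow> int (card (fundamental_solutions A d U U')) = N) \<and>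
            int (card (LA_classes A d)) = N"
proof -
  have n: "n = r + k" using assms by simp
  have A: "A \<in> carrier_mat r (r + k)" using assms(1) unfolding n .
  define m where "m = (\<Prod>i=1..l. p i ^ e i)"
  have p_pos: "0 < p i ^ e i" if "i \<in> {1..l}" for i
    using assms(7)[OF that] prime_gt_0_nat by simp
  then have m: "m > 0" by (auto simp: m_def intro!: prod_pos)
  have d: "d = greatest_divisor A * int m"
    using assms(10) by (simp add: m_def)
  have nz: "greatest_divisor A \<noteq> 0" using assms(5) d by auto
  have "coprime (p i ^ e i) (p j ^ e j)" if "i \<in> {1..l}" "j \<in> {1..l}" "i \<noteq> j" for i j
    using assms(7,8) that by (metis coprime_power_left_iff coprime_power_right_iff inj_onD primes_coprime)
  then have "hnf_count k m = (\<Prod>i=1..l. hnf_count k (p i ^ e i))"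
    unfolding m_def using p_pos by (intro hnf_count_prod_coprime) auto
  also have "\<dots> = (\<Prod>i=1..l. \<Sum>js\<in>index_sequences (e i) k. p i ^ (e i * k - sum_list js))"
    using assms(7) by (intro prod.cong) (auto simp: hnf_count_prime_power)
  finally have count: "int (hnf_count k m) =
      (\<Prod>i=1..l. \<Sum>js\<in>index_sequences (e i) k. int (p i) ^ (e i * k - sum_list js))"
    by simp
  have card_fund: "int (card (fundamental_solutions A d U U')) =
      greatest_divisor A ^ k * int (hnf_count k m) \<and>
      card (LA_classes A d) = card (fundamental_solutions A d U U')"
    if "row_reduction A U U' N r k" for U U' N
  proof -
    interpret row_reduction A U U' N r k by fact
    show ?thesis
      using card_fundamental_solutions[OF d[unfolded greatest_divisor_eq] m]
        card_LA_classes[OF d[unfolded greatest_divisor_eq] m] det_N_pos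
      by (simp add: greatest_divisor_eq)
  qed
  have "int (card (fundamental_solutions A d U U')) = greatest_divisor A ^ k * int (hnf_count k m)"
    if UU': "reducing_pair A U U'" for U U'
  proof -
    have "dim_row A = r" "dim_col A = r + k" using A by auto
    then obtain N where "row_reduction A U U' N r k"
      using UU' A by (auto simp: reducing_pair_def Let_def row_reduction_def)
    then show ?thesis using card_fund by blast
  qed
  \<comment> \<open>The classes do not refer to any pair of matrices, so the count obtained from one
    constructed reduction suffices.\<close>
  moreover have "int (card (LA_classes A d)) = greatest_divisor A ^ k * int (hnf_count k m)"
    using row_reduction_exists[OF A nz] card_fund by metis
  ultimately show ?thesis unfolding count Let_def by blast
qed

end
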